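(* Let $n\ge 1$, let $B,W\in\mathbb{R}^{n\times n}$ be row-stochastic matrices, and let $A=\operatorname{diag}(a)\in\mathbb{R}^{n\times n}$ be a diagonal matrix with $0\le A\le I$, where $a\in\mathbb{R}^n$. Let $(\lambda(k))_{k\ge 0}$ be a Markov chain with state space $\mathcal{S}=\{0,1\}^n\subset\mathbb{R}^n$, transition matrix $P=(p_{ij})_{i,j\in\mathcal{S}}$ and initial distribution $\pi(0)$. Consider the process $$x(k+1)=Bx(k)+A\big(\lambda(k)-Wx(k)\big),\qquad k\ge 0,\qquad x(0)=x_0\in\mathbb{R}^n.$$ Suppose $P$ is irreducible and aperiodic. Then the sequence $x(k)$ is mean square stable if and only if $B-AW$ is Schur stable. Moreover, for any initial distribution $\pi(0)$ of $\lambda(0)$, $\mathbb{E}(x(k))$ converges as $k\to\infty$ to $$(I-B+AW)^{-1}\sum_{i\in\mathcal{S}}\pi^*_i\operatorname{diag}(i)\,a,$$ where $\pi^*=(\pi^*_i)_{i\in\mathcal{S}}$ is the unique invariant distribution of $P$.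
   Context: A square matrix is row stochastic if its entries are nonnegative and each row sums to $1$. A square matrix $H$ is Schur stable if its spectral radius satisfies $\rho(H)<1$. For a vector $\eta\in\mathbb{R}^n$, $\operatorname{diag}(\eta)$ is the diagonal matrix with $i$th diagonal entry $\eta_i$; in particular for a state $i\in\mathcal{S}=\{0,1\}^n$, which is itself a vector in $\mathbb{R}^n$, $\operatorname{diag}(i)$ is the corresponding $0$-$1$ diagonal matrix. The initial distribution means $\Pr(\lambda(0)=i)=\pi_i(0)$; distributions are row vectors and $\pi^*$ is invariant for $P$ if $\pi^*P=\pi^*$. Mean square stability: the system is mean square stable if for any initial condition $x(0)$ there exist $\mu\in\mathbb{R}^n$ and a matrix $Q\in\mathbb{R}^{n\times n}$, both independent of $x(0)$, such that $\lim_{k\to\infty}\|\mathbb{E}(x(k))-\mu\|=0$ and $\lim_{k\to\infty}\|\mathbb{E}(x(k)x(k)^\top)-Q\|=0$.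
   Formalization: The convergence of E(x(k)) to the stated limit is asserted only when B−AW is Schur stable; without this, I−B+AW may be singular (e.g. A=0, B=I) and the limit undefined. *)

theory Defs
  imports "HOL-Probability.Probability"
begin

definition stochastic_on :: "'s set \<Rightarrow> ('s \<Rightarrow> 's \<Rightarrow> real) \<Rightarrow> bool" where
  "stochastic_on S p \<longleftrightarrow> (\<forall>i\<in>S. \<forall>j\<in>S. 0 \<le> p i j) \<and> (\<forall>i\<in>S. (\<Sum>j\<in>S. p i j) = 1)"

definition distribution_on :: "'s set \<Rightarrow> ('s \<Rightarrow> real) \<Rightarrow> bool" where
  "distribution_on S \<pi> \<longleftrightarrow> (\<forall>i\<in>S. 0 \<le> \<pi> i) \<and> (\<Sum>i\<in>S. \<pi> i) = 1"

definition invariant_distribution_on :: "'s set \<Rightarrow> ('s \<Rightarrow> 's \<Rightarrow> real) \<Rightarrow> ('s \<Rightarrow> real) \<Rightarrow> bool" where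
  "invariant_distribution_on S p \<pi> \<longleftrightarrow>
     distribution_on S \<pi> \<and> (\<forall>j\<in>S. (\<Sum>i\<in>S. \<pi> i * p i j) = \<pi> j)"

primrec power_on :: "'s set \<Rightarrow> ('s \<Rightarrow> 's \<Rightarrow> real) \<Rightarrow> nat \<Rightarrow> 's \<Rightarrow> 's \<Rightarrow> real" where
  "power_on S p 0 = (\<lambda>i j. if i = j then 1 else 0)"
| "power_on S p (Suc m) = (\<lambda>i j. \<Sum>l\<in>S. power_on S p m i l * p l j)"

definition irreducible_on :: "'s set \<Rightarrow> ('s \<Rightarrow> 's \<Rightarrow> real) \<Rightarrow> bool" where
  "irreducible_on S p \<longleftrightarrow> (\<forall>i\<in>S. \<forall>j\<in>S. \<exists>m. 0 < power_on S p m i j)"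

definition aperiodic_on :: "'s set \<Rightarrow> ('s \<Rightarrow> 's \<Rightarrow> real) \<Rightarrow> bool" where
  "aperiodic_on S p \<longleftrightarrow> (\<forall>i\<in>S. Gcd {m. 1 \<le> m \<and> 0 < power_on S p m i i} = 1)"

text \<open>The Markov property is required for every history \<open>h 0, \<dots>, h k\<close> of positive
  probability. Measurability into \<^term>\<open>count_space S\<close> includes that all values lie in \<open>S\<close>.\<close>

definition markov_chain_on ::
  "'s set \<Rightarrow> ('s \<Rightarrow> 's \<Rightarrow> real) \<Rightarrow> ('s \<Rightarrow> real) \<Rightarrow> 'w measure \<Rightarrow> (nat \<Rightarrow> 'w \<Rightarrow> 's) \<Rightarrow> bool" where
  "markov_chain_on S p \<pi>0 M X \<longleftrightarrow>
     prob_space M \<and> stochastic_on S p \<and> distribution_on S \<pi>0 \<and>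
     (\<forall>k. X k \<in> measurable M (count_space S)) \<and>
     (\<forall>i\<in>S. \<P>(\<omega> in M. X 0 \<omega> = i) = \<pi>0 i) \<and>
     (\<forall>k. \<forall>h. \<forall>j\<in>S. (\<forall>m\<le>k. h m \<in> S) \<longrightarrow> 0 < \<P>(\<omega> in M. \<forall>m\<le>k. X m \<omega> = h m) \<longrightarrow>
        \<P>(\<omega> in M. X (Suc k) \<omega> = j \<bar> \<forall>m\<le>k. X m \<omega> = h m) = p (h k) j)"

definition row_stochastic :: "real^'n^'n \<Rightarrow> bool" where
  "row_stochastic A \<longleftrightarrow> stochastic_on UNIV (\<lambda>i j. A $ i $ j)"

definition diag_matrix :: "real^'n \<Rightarrow> real^'n^'n" where
  "diag_matrix v = (\<chi> i j. if i = j then v $ i else 0)"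

definition outer_square :: "real^'n \<Rightarrow> real^'n^'n" where
  "outer_square v = (\<chi> i j. v $ i * v $ j)"

definition complex_eigenvalues :: "real^'n^'n \<Rightarrow> complex set" where
  "complex_eigenvalues A =
     {z. \<exists>v :: complex^'n. v \<noteq> 0 \<and> map_matrix complex_of_real A *v v = z *s v}"

text \<open>The set of eigenvalues is finite and nonempty, so \<^term>\<open>Max\<close> is well defined.\<close>

definition real_spectral_radius :: "real^'n^'n \<Rightarrow> real" where
  "real_spectral_radius A = Max (cmod ` complex_eigenvalues A)"

definition schur_stable :: "real^'n^'n \<Rightarrow> bool" where
  "schur_stable A \<longleftrightarrow> real_spectral_radius A < 1"

definition binary_states :: "(real^'n) set" where
  "binary_states = {s. \<forall>i. s $ i \<in> {0, 1}}"

primrec trajectory ::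
  "real^'n^'n \<Rightarrow> real^'n^'n \<Rightarrow> real^'n^'n \<Rightarrow> (nat \<Rightarrow> 'w \<Rightarrow> real^'n) \<Rightarrow> real^'n \<Rightarrow> nat \<Rightarrow> 'w \<Rightarrow> real^'n" where
  "trajectory B A W X x0 0 = (\<lambda>\<omega>. x0)"
| "trajectory B A W X x0 (Suc k) =
     (\<lambda>\<omega>. B *v trajectory B A W X x0 k \<omega> + A *v (X k \<omega> - W *v trajectory B A W X x0 k \<omega>))"

text \<open>Here \<open>x x0\<close> is the process started in \<open>x0\<close>.\<close>

definition mean_square_stable :: "'w measure \<Rightarrow> (real^'n \<Rightarrow> nat \<Rightarrow> 'w \<Rightarrow> real^'n) \<Rightarrow> bool" where
  "mean_square_stable M x \<longleftrightarrow>
     (\<exists>\<mu> :: real^'n. \<exists>Q :: real^'n^'n. \<forall>x0.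
        (\<lambda>k. norm ((\<integral>\<omega>. x x0 k \<omega> \<partial>M) - \<mu>)) \<longlonglongrightarrow> 0 \<and>
        (\<lambda>k. norm ((\<integral>\<omega>. outer_square (x x0 k \<omega>) \<partial>M) - Q)) \<longlonglongrightarrow> 0)"

end

theory Submission
  imports Defs "HOL-Computational_Algebra.Fundamental_Theorem_Algebra"
begin

text \<open>
  Put \<open>H = B - A W\<close>. The process satisfies \<open>x(k+1) = H x(k) + A \<lambda>(k)\<close>, hence
  \<open>x(k) = H\<^sup>k x\<^sub>0 + \<Sum>\<^sub>j\<^sub><\<^sub>k H\<^sup>j A \<lambda>(k-1-j)\<close>: the start contributes a deterministic transient, and the input
  of age \<open>j\<close> enters with weight \<open>H\<^sup>j\<close>.

  Stability of the process implies stability of \<open>H\<close> because the expectations for the starts \<open>v\<close> and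
  0 differ by \<open>H\<^sup>k v\<close>. If both have the same limit, then \<open>H\<^sup>k v\<close> tends to 0 for all \<open>v\<close>, and an
  eigenvalue of modulus at least 1 would contradict this on the real and imaginary parts of an
  eigenvector (\<open>schur_stable_if_orbits_vanish\<close>).

  Conversely, if all eigenvalues have modulus below 1, then \<open>H\<^sup>k\<close> decays geometrically
  (\<open>schur_stable_geometric\<close>). A dominated convergence argument for sums (Tannery's theorem) then shows
  that a moment \<open>E(Y(k) x(k))\<close>, with \<open>Y\<close> uniformly bounded, converges as soon as \<open>E(Y(k) A \<lambda>(k-1-j))\<close> does for
  each fixed age \<open>j\<close> (\<open>moment_convergent\<close>). Taking \<open>Y = 1\<close> gives the mean. Taking for \<open>Y\<close> first a
  component of an input and then a component of the state gives the second moments. Besides boundedness,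
  the only fact needed about \<open>\<lambda>\<close> is that the joint law of \<open>\<lambda>(m)\<close> and \<open>\<lambda>(m+d)\<close> converges for each fixed lag \<open>d\<close>
  (\<open>lagged_correlation_tendsto\<close>). The limits do not depend on \<open>x\<^sub>0\<close>, since \<open>H\<^sup>k x\<^sub>0\<close> tends to 0, and the
  limit of the mean solves \<open>\<mu> = H \<mu> + \<Sum>\<^sub>i \<pi>\<^sub>i A i\<close>.

  The convergence of the law of \<open>\<lambda>\<close> is the convergence theorem for finite irreducible aperiodic chains
  (\<open>finite_chain_converges\<close>): some power of the transition matrix is positive, and a positive
  stochastic matrix contracts the oscillation of functions on the state space.
\<close>

section \<open>Convergence of finite aperiodic chains\<close>

text \<open>Let \<open>d\<close> be the least positive difference of two elements of \<open>G\<close>. Euclidean division by \<open>d\<close>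
  shows that \<open>d\<close> divides every element, so \<open>d = 1\<close> and \<open>G\<close> contains two consecutive numbers
  \<open>b\<close>, \<open>b + 1\<close>; these generate everything from \<open>b\<^sup>2\<close> on. Applied to the return times of a state,
  this turns aperiodicity into positivity of all high return probabilities.\<close>

lemma additive_Gcd_1_cofinite:
  fixes G :: "nat set"
  assumes add: "\<And>a b. a \<in> G \<Longrightarrow> b \<in> G \<Longrightarrow> a + b \<in> G" and zero: "0 \<in> G"
    and gcd: "Gcd {m \<in> G. 1 \<le> m} = 1"
  shows "\<exists>N. \<forall>n\<ge>N. n \<in> G"
proof -
  define D where "D d \<longleftrightarrow> 0 < d \<and> (\<exists>b\<in>G. b + d \<in> G)" for d
  have mult: "q * b \<in> G" if "b \<in> G" for q b
    by (induction q) (use that add zero in auto)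
  have "{m \<in> G. 1 \<le> m} \<noteq> {}"
    using gcd by (metis Gcd_empty zero_neq_one)
  then obtain s where s: "s \<in> G" "1 \<le> s" by blast
  with zero have "D s" by (auto simp: D_def intro!: bexI[of _ 0])
  define d where "d = (LEAST d. D d)"
  have Dd: "D d" unfolding d_def by (rule LeastI[of D, OF \<open>D s\<close>])
  have min: "d \<le> e" if "D e" for e unfolding d_def by (rule Least_le[of D, OF that])
  from Dd obtain b where b: "b \<in> G" "b + d \<in> G" "0 < d" by (auto simp: D_def)
  have "d dvd m" if m: "m \<in> G" for m
  proof (rule ccontr)
    assume "\<not> d dvd m"
    then have r: "0 < m mod d" by (auto simp: mod_greater_zero_iff_not_dvd)
    define q where "q = m div d"
    \<comment> \<open>A nonzero remainder \<open>m mod d\<close> is again a difference of two elements of \<open>G\<close>, below the minimum.\<close>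
    have "q * (b + d) + m mod d = m + q * b"
      unfolding q_def by (simp add: algebra_simps)
    then have "D (m mod d)"
      unfolding D_def using r mult[OF b(2), of q] add[OF m mult[OF b(1), of q]] by metis
    from min[OF this] b(3) show False by (meson mod_less_divisor not_le)
  qed
  then have "d dvd Gcd {m \<in> G. 1 \<le> m}" by (intro Gcd_greatest) auto
  with gcd have d1: "d = 1" by simp
  have "n \<in> G" if n: "b * b \<le> n" for n
  proof (cases "b = 0")
    case True
    then show ?thesis using mult[of 1 n] b d1 by simp
  next
    case False
    have "n mod b \<le> n div b"
      using False n by (metis less_eq_div_iff_mult_less_eq less_imp_le_nat
          mod_less_divisor neq0_conv order_trans)
    \<comment> \<open>With \<open>n = q b + r\<close> and \<open>r < b \<le> q\<close>: use \<open>r\<close> copies of \<open>b + 1\<close> and \<open>q - r\<close> copies of \<open>b\<close>.\<close>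
    then have "n = (n mod b) * (b + d) + (n div b - n mod b) * b"
      unfolding d1 by (simp add: algebra_simps diff_mult_distrib2 mult_le_mono2)
    then show ?thesis by (metis add mult b(1,2))
  qed
  then show ?thesis by blast
qed

lemma power_on_nonneg:
  assumes "stochastic_on S p" "i \<in> S" "j \<in> S"
  shows "0 \<le> power_on S p m i j"
  using assms(2,3)
  by (induction m arbitrary: j)
    (use assms(1) in \<open>auto simp: stochastic_on_def intro!: sum_nonneg mult_nonneg_nonneg\<close>)

lemma power_on_add:
  assumes "finite S" "i \<in> S" "j \<in> S"
  shows "power_on S p (m + n) i j = (\<Sum>l\<in>S. power_on S p m i l * power_on S p n l j)"
  using assms(3)
proof (induction n arbitrary: j)
  case 0
  have "(\<Sum>l\<in>S. power_on S p m i l * (if l = j then 1 else 0)) = power_on S p m i j"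
    using assms(1) 0 by (subst sum.mono_neutral_right[of S "{j}"]) auto
  then show ?case by simp
next
  case (Suc n)
  have "power_on S p (m + Suc n) i j
      = (\<Sum>l\<in>S. \<Sum>h\<in>S. power_on S p m i h * power_on S p n h l * p l j)"
    by (auto simp: Suc.IH sum_distrib_right intro!: sum.cong)
  also have "\<dots> = (\<Sum>h\<in>S. power_on S p m i h * power_on S p (Suc n) h j)"
    by (subst sum.swap) (simp add: sum_distrib_left mult.assoc)
  finally show ?case .
qed

lemma stochastic_on_power_on:
  assumes "finite S" "stochastic_on S p"
  shows "stochastic_on S (power_on S p m)"
proof -
  have "(\<Sum>j\<in>S. power_on S p m i j) = 1" if i: "i \<in> S" for i
  proof (induction m)
    case 0
    have "(\<Sum>j\<in>S. if i = j then 1 else 0) = (1::real)"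
      using assms(1) i by (subst sum.mono_neutral_right[of S "{i}"]) auto
    then show ?case by simp
  next
    case (Suc m)
    have "(\<Sum>j\<in>S. power_on S p (Suc m) i j) = (\<Sum>l\<in>S. power_on S p m i l * (\<Sum>j\<in>S. p l j))"
      by (simp add: sum_distrib_left) (rule sum.swap)
    also have "\<dots> = 1" using Suc assms(2) by (simp add: stochastic_on_def)
    finally show ?case .
  qed
  then show ?thesis using power_on_nonneg[OF assms(2)] by (simp add: stochastic_on_def)
qed

lemma power_on_add_pos:
  assumes "finite S" "stochastic_on S p" "i \<in> S" "l \<in> S" "j \<in> S"
    and "0 < power_on S p m i l" "0 < power_on S p n l j"
  shows "0 < power_on S p (m + n) i j"
proof -
  have "0 < power_on S p m i l * power_on S p n l j" using assms by simp
  also have "\<dots> \<le> (\<Sum>l\<in>S. power_on S p m i l * power_on S p n l j)"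
    by (rule member_le_sum) (use assms power_on_nonneg[OF assms(2)] in auto)
  finally show ?thesis using power_on_add[OF assms(1,3,5)] by metis
qed

text \<open>A path from \<open>i\<close> to \<open>j\<close> exists by irreducibility, and it may be preceded by a loop at \<open>i\<close> of any
  sufficiently large length; hence all pairs can be joined by paths of one common length.\<close>

lemma aperiodic_irreducible_power_pos:
  assumes fin: "finite S" and st: "stochastic_on S p"
    and irr: "irreducible_on S p" and ap: "aperiodic_on S p"
  shows "\<exists>N. \<forall>i\<in>S. \<forall>j\<in>S. 0 < power_on S p N i j"
proof -
  have "\<exists>N. \<forall>n\<ge>N. 0 < power_on S p n i i" if i: "i \<in> S" for i
  proof -
    have "\<exists>N. \<forall>n\<ge>N. n \<in> {m. 0 < power_on S p m i i}"
    proof (rule additive_Gcd_1_cofinite)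
      show "Gcd {m \<in> {m. 0 < power_on S p m i i}. 1 \<le> m} = 1"
        using ap i unfolding aperiodic_on_def by (simp add: conj_commute)
    qed (use power_on_add_pos[OF fin st i i i] in auto)
    then show ?thesis by simp
  qed
  then obtain R where R: "\<And>i n. i \<in> S \<Longrightarrow> R i \<le> n \<Longrightarrow> 0 < power_on S p n i i" by metis
  from irr obtain m where m: "\<And>i j. i \<in> S \<Longrightarrow> j \<in> S \<Longrightarrow> 0 < power_on S p (m i j) i j"
    unfolding irreducible_on_def by metis
  define N where "N = (\<Sum>i\<in>S. R i) + (\<Sum>(i, j)\<in>S \<times> S. m i j)"
  have "0 < power_on S p N i j" if i: "i \<in> S" and j: "j \<in> S" for i j
  proof -
    have "R i \<le> (\<Sum>i\<in>S. R i)" by (rule member_le_sum) (use fin i in auto)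
    moreover have "m i j \<le> (\<Sum>(i, j)\<in>S \<times> S. m i j)"
      using member_le_sum[of "(i, j)" "S \<times> S" "\<lambda>(i, j). m i j"] fin i j by auto
    ultimately have "R i \<le> N - m i j" "N - m i j + m i j = N" by (auto simp: N_def)
    then show ?thesis
      using power_on_add_pos[OF fin st i i j R[OF i] m[OF i j], of "N - m i j"] by simp
  qed
  then show ?thesis by blast
qed

text \<open>The width of the range of \<open>f\<close> on \<open>S\<close>. It is the quantity that averaging against a stochastic
  matrix contracts, and it measures how far a column of \<open>p\<^sup>k\<close> is from being constant.\<close>

definition oscillation_on :: "'s set \<Rightarrow> ('s \<Rightarrow> real) \<Rightarrow> real" where
  "oscillation_on S f = Max (f ` S) - Min (f ` S)"

lemma abs_diff_le_oscillation:
  assumes "finite S" "i \<in> S" "f i \<le> c" "c \<le> Max (f ` S)"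
  shows "\<bar>f i - c\<bar> \<le> oscillation_on S f"
proof -
  have "Min (f ` S) \<le> f i" using assms(1,2) by simp
  then show ?thesis using assms(3,4) by (simp add: oscillation_on_def)
qed

text \<open>Every average gives weight at least \<open>\<delta>\<close> to a point where \<open>f\<close> is minimal, which pulls it below
  the maximum by at least \<open>\<delta>\<close> times the oscillation.\<close>

lemma stochastic_average_bounds:
  fixes f :: "'s \<Rightarrow> real"
  assumes fin: "finite S" and ne: "S \<noteq> {}" and st: "stochastic_on S q" and i: "i \<in> S"
    and low: "\<And>i j. i \<in> S \<Longrightarrow> j \<in> S \<Longrightarrow> \<delta> \<le> q i j"
  shows "(\<Sum>l\<in>S. q i l * f l) \<le> Max (f ` S) - \<delta> * oscillation_on S f"
    and "Min (f ` S) \<le> (\<Sum>l\<in>S. q i l * f l)"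
proof -
  have q: "\<And>l. l \<in> S \<Longrightarrow> 0 \<le> q i l" and q1: "(\<Sum>l\<in>S. q i l) = 1"
    using st i by (auto simp: stochastic_on_def)
  have "Min (f ` S) \<in> f ` S" using fin ne by (intro Min_in) auto
  then obtain l0 where l0: "l0 \<in> S" "f l0 = Min (f ` S)" by auto
  have gap: "0 \<le> Max (f ` S) - f l" if "l \<in> S" for l using fin that by simp
  have "\<delta> * oscillation_on S f \<le> q i l0 * (Max (f ` S) - f l0)"
    unfolding oscillation_on_def l0(2)[symmetric]
    by (intro mult_right_mono low[OF i l0(1)] gap[OF l0(1)])
  also have "\<dots> \<le> (\<Sum>l\<in>S. q i l * (Max (f ` S) - f l))"
    by (rule member_le_sum[OF l0(1)]) (use q gap fin in auto)
  also have "\<dots> = Max (f ` S) - (\<Sum>l\<in>S. q i l * f l)"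
    by (simp add: right_diff_distrib sum_subtractf sum_distrib_right[symmetric] q1)
  finally show "(\<Sum>l\<in>S. q i l * f l) \<le> Max (f ` S) - \<delta> * oscillation_on S f" by simp
  have "Min (f ` S) = (\<Sum>l\<in>S. q i l * Min (f ` S))" by (simp add: sum_distrib_right[symmetric] q1)
  also have "\<dots> \<le> (\<Sum>l\<in>S. q i l * f l)" by (intro sum_mono mult_left_mono q) (use fin in auto)
  finally show "Min (f ` S) \<le> (\<Sum>l\<in>S. q i l * f l)" .
qed

text \<open>Doeblin's contraction: a stochastic matrix whose entries are all at least \<open>\<delta>\<close> shrinks the
  oscillation by the factor \<open>1 - \<delta>\<close>. With \<open>\<delta> = 0\<close> it says that averaging never increases it.\<close>

lemma oscillation_average_le:
  assumes fin: "finite S" and ne: "S \<noteq> {}" and st: "stochastic_on S q"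
    and low: "\<And>i j. i \<in> S \<Longrightarrow> j \<in> S \<Longrightarrow> \<delta> \<le> q i j"
  shows "oscillation_on S (\<lambda>i. \<Sum>l\<in>S. q i l * f l) \<le> (1 - \<delta>) * oscillation_on S f"
proof -
  let ?g = "\<lambda>i. \<Sum>l\<in>S. q i l * f l"
  have "Max (?g ` S) \<le> Max (f ` S) - \<delta> * oscillation_on S f"
    using stochastic_average_bounds(1)[OF fin ne st _ low] fin ne by (subst Max_le_iff) auto
  moreover have "Min (f ` S) \<le> Min (?g ` S)"
    using stochastic_average_bounds(2)[OF fin ne st _ low] fin ne by (subst Min_ge_iff) auto
  ultimately have "oscillation_on S ?g
      \<le> Max (f ` S) - \<delta> * oscillation_on S f - Min (f ` S)"
    unfolding oscillation_on_def[of S ?g] by linarith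
  then show ?thesis by (simp add: left_diff_distrib oscillation_on_def[of S f])
qed

text \<open>Each column of \<open>p\<^sup>k\<close> flattens out: its oscillation decreases, and by the contraction over \<open>N\<close>
  steps its limit \<open>L\<close> satisfies \<open>L \<le> (1 - \<delta>) L\<close>, so \<open>L = 0\<close>. The column maxima decrease as well
  and hence converge, and all entries of the column share their limit.\<close>

lemma power_on_tendsto:
  assumes fin: "finite S" and ne: "S \<noteq> {}" and st: "stochastic_on S p"
    and irr: "irreducible_on S p" and ap: "aperiodic_on S p" and j: "j \<in> S"
  shows "\<exists>L. \<forall>i\<in>S. (\<lambda>k. power_on S p k i j) \<longlonglongrightarrow> L"
proof -
  define f where "f k i = power_on S p k i j" for k i
  define osc where "osc k = oscillation_on S (f k)" for k
  define top where "top k = Max (f k ` S)" for k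
  have f_add: "f (n + k) i = (\<Sum>l\<in>S. power_on S p n i l * f k l)" if "i \<in> S" for n k i
    unfolding f_def using power_on_add[OF fin that j] .
  have osc_add: "osc (n + k) = oscillation_on S (\<lambda>i. \<Sum>l\<in>S. power_on S p n i l * f k l)" for n k
    unfolding osc_def oscillation_on_def using f_add[of _ n k] by (simp cong: image_cong)
  note avg = oscillation_average_le[OF fin ne stochastic_on_power_on[OF fin st]]
  note bnd = stochastic_average_bounds[OF fin ne stochastic_on_power_on[OF fin st] _
      power_on_nonneg[OF st]]
  obtain N where N: "\<And>i j. i \<in> S \<Longrightarrow> j \<in> S \<Longrightarrow> 0 < power_on S p N i j"
    using aperiodic_irreducible_power_pos[OF fin st irr ap] by blast
  define \<delta> where "\<delta> = Min ((\<lambda>(i, j). power_on S p N i j) ` (S \<times> S))"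
  have \<delta>: "0 < \<delta>"
    unfolding \<delta>_def using fin ne N by (subst Min_gr_iff) auto
  have \<delta>_le: "\<delta> \<le> power_on S p N i j" if "i \<in> S" "j \<in> S" for i j
    unfolding \<delta>_def using fin that by (intro Min_le) force+
  have osc0: "0 \<le> osc k" for k
    unfolding osc_def using abs_diff_le_oscillation[OF fin j, of "f k" "f k j"] fin j by simp
  have "osc (Suc k) \<le> osc k" for k
    using avg[of 0 1 "f k", OF power_on_nonneg[OF st]] osc_add[of 1 k] by (simp add: osc_def)
  then have "decseq osc" by (rule decseq_SucI)
  then obtain L where L: "osc \<longlonglongrightarrow> L" using decseq_convergent[of osc 0] osc0 by blast
  have "osc (N + k) \<le> (1 - \<delta>) * osc k" for k
    using avg[of \<delta> N "f k", OF \<delta>_le] osc_add[of N k] by (simp add: osc_def)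
  then have "L \<le> (1 - \<delta>) * L"
    using LIMSEQ_le[OF LIMSEQ_ignore_initial_segment[OF L, of N] tendsto_mult_left[OF L, of "1 - \<delta>"]]
    by (auto simp: add.commute)
  moreover have "0 \<le> L" using LIMSEQ_le_const[OF L, of 0] osc0 by auto
  ultimately have "L = 0"
    using \<delta> by (simp add: left_diff_distrib mult_le_0_iff order_antisym)
  with L have osc_lim: "osc \<longlonglongrightarrow> 0" by simp
  have top_ge: "f k i \<le> top k" if "i \<in> S" for k i
    unfolding top_def using fin that by simp
  have "top (Suc k) \<le> top k" for k
    using bnd(1)[of _ 1 "f k"] f_add[of _ 1 k] fin ne
    unfolding top_def by (subst Max_le_iff) auto
  then have "decseq top" by (rule decseq_SucI)
  moreover have "0 \<le> top k" for k
  proof -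
    have "0 \<le> f k j" unfolding f_def by (rule power_on_nonneg[OF st j j])
    then show ?thesis using top_ge[OF j, of k] by simp
  qed
  ultimately obtain T where T: "top \<longlonglongrightarrow> T" using decseq_convergent[of top 0] by blast
  have "(\<lambda>k. f k i) \<longlonglongrightarrow> T" if i: "i \<in> S" for i
  proof -
    have "\<bar>f k i - top k\<bar> \<le> osc k" for k
      unfolding osc_def using abs_diff_le_oscillation[of S i "f k" "top k"] fin i top_ge[OF i]
      by (simp add: top_def)
    then have "(\<lambda>k. f k i - top k) \<longlonglongrightarrow> 0"
      by (intro Lim_null_comparison[OF _ osc_lim]) auto
    from tendsto_add[OF this T] show ?thesis by simp
  qed
  then show ?thesis unfolding f_def by blast
qed

text \<open>The common limits of the columns form the invariant distribution: invariance comes from letting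
  \<open>k\<close> tend to infinity in \<open>p\<^sup>k\<^sup>+\<^sup>1 = p\<^sup>k p\<close>, and uniqueness from doing so in \<open>\<pi>' = \<pi>' p\<^sup>k\<close>.\<close>

theorem finite_chain_converges:
  assumes fin: "finite S" and ne: "S \<noteq> {}" and st: "stochastic_on S p"
    and irr: "irreducible_on S p" and ap: "aperiodic_on S p"
  obtains \<pi> where "invariant_distribution_on S p \<pi>"
    and "\<forall>\<pi>'. invariant_distribution_on S p \<pi>' \<longrightarrow> (\<forall>i\<in>S. \<pi>' i = \<pi> i)"
    and "\<forall>i\<in>S. \<forall>j\<in>S. (\<lambda>k. power_on S p k i j) \<longlonglongrightarrow> \<pi> j"
proof -
  obtain \<pi> where \<pi>: "\<And>i j. i \<in> S \<Longrightarrow> j \<in> S \<Longrightarrow> (\<lambda>k. power_on S p k i j) \<longlonglongrightarrow> \<pi> j"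
    using power_on_tendsto[OF assms] by metis
  obtain i0 where i0: "i0 \<in> S" using ne by blast
  have "distribution_on S \<pi>"
    unfolding distribution_on_def
  proof
    show "\<forall>j\<in>S. 0 \<le> \<pi> j"
      using LIMSEQ_le_const[OF \<pi>[OF i0]] power_on_nonneg[OF st i0] by blast
    have "(\<lambda>k. \<Sum>j\<in>S. power_on S p k i0 j) \<longlonglongrightarrow> (\<Sum>j\<in>S. \<pi> j)"
      by (intro tendsto_sum \<pi> i0)
    moreover have "(\<Sum>j\<in>S. power_on S p k i0 j) = 1" for k
      using stochastic_on_power_on[OF fin st] i0 by (simp add: stochastic_on_def)
    ultimately show "(\<Sum>j\<in>S. \<pi> j) = 1" by (simp add: LIMSEQ_const_iff)
  qed
  moreover have "(\<Sum>i\<in>S. \<pi> i * p i j) = \<pi> j" if j: "j \<in> S" for j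
  proof -
    have "(\<lambda>k. \<Sum>i\<in>S. power_on S p k i0 i * p i j) \<longlonglongrightarrow> (\<Sum>i\<in>S. \<pi> i * p i j)"
      by (intro tendsto_intros \<pi> i0)
    moreover have "(\<lambda>k. \<Sum>i\<in>S. power_on S p k i0 i * p i j) \<longlonglongrightarrow> \<pi> j"
      using LIMSEQ_Suc[OF \<pi>[OF i0 j]] by simp
    ultimately show ?thesis by (rule LIMSEQ_unique)
  qed
  ultimately have inv: "invariant_distribution_on S p \<pi>"
    by (simp add: invariant_distribution_on_def)
  have uniq: "\<pi>' j = \<pi> j" if inv': "invariant_distribution_on S p \<pi>'" and j: "j \<in> S" for \<pi>' j
  proof -
    have "(\<Sum>i\<in>S. \<pi>' i * power_on S p k i l) = \<pi>' l" if "l \<in> S" for k l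
      using that
    proof (induction k arbitrary: l)
      case 0
      have "(\<Sum>i\<in>S. \<pi>' i * (if i = l then 1 else 0)) = \<pi>' l"
        using fin 0 by (subst sum.mono_neutral_right[of S "{l}"]) auto
      then show ?case by simp
    next
      case (Suc k)
      have "(\<Sum>i\<in>S. \<pi>' i * power_on S p (Suc k) i l)
          = (\<Sum>h\<in>S. (\<Sum>i\<in>S. \<pi>' i * power_on S p k i h) * p h l)"
        by (simp add: sum_distrib_left sum_distrib_right mult.assoc) (rule sum.swap)
      also have "\<dots> = \<pi>' l"
        using Suc inv' by (simp add: invariant_distribution_on_def)
      finally show ?case .
    qed
    moreover have "(\<lambda>k. \<Sum>i\<in>S. \<pi>' i * power_on S p k i j) \<longlonglongrightarrow> (\<Sum>i\<in>S. \<pi>' i * \<pi> j)"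
      by (intro tendsto_intros \<pi> j)
    moreover have "(\<Sum>i\<in>S. \<pi>' i * \<pi> j) = \<pi> j"
      using inv' unfolding invariant_distribution_on_def distribution_on_def
      by (simp add: sum_distrib_right[symmetric])
    ultimately show ?thesis using j by (simp add: LIMSEQ_const_iff)
  qed
  show thesis by (rule that[OF inv]) (use uniq \<pi> in blast)+
qed

section \<open>Spectral radius and decay of matrix powers\<close>

lemma exists_linear_relation_seq:
  fixes f :: "nat \<Rightarrow> 'a::euclidean_space"
  shows "\<exists>c. (\<exists>i\<le>DIM('a). c i \<noteq> 0) \<and> (\<Sum>i\<le>DIM('a). c i *\<^sub>R f i) = 0"
proof (cases "inj_on f {..DIM('a)}")
  case True
  then have "dependent (f ` {..DIM('a)})"
    by (intro dependent_biggerset) (simp_all add: card_image)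
  then obtain u v where u: "v \<in> f ` {..DIM('a)}" "u v \<noteq> 0"
      "(\<Sum>v\<in>f ` {..DIM('a)}. u v *\<^sub>R v) = 0"
    by (auto simp: dependent_finite)
  with True show ?thesis
    by (intro exI[of _ "u \<circ> f"]) (auto simp: sum.reindex)
next
  case False
  then obtain i j where ij: "i \<le> DIM('a)" "j \<le> DIM('a)" "f i = f j" "i \<noteq> j"
    by (auto simp: inj_on_def)
  define c where "c l = (if l = i then 1 else if l = j then - 1 else 0::real)" for l
  have "(\<Sum>l\<le>DIM('a). c l *\<^sub>R f l) = (\<Sum>l\<in>{i, j}. c l *\<^sub>R f l)"
    using ij by (intro sum.mono_neutral_right) (auto simp: c_def)
  also have "\<dots> = 0" using ij by (simp add: c_def)
  finally show ?thesis using ij by (intro exI[of _ c]) (auto simp: c_def intro!: exI[of _ i])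
qed

text \<open>The vector \<open>p(T) v\<close>, written with iterates of \<open>(*v) T\<close>, which are also what describes the orbits
  of the system.\<close>

definition poly_action :: "('a::field)^'n^'n \<Rightarrow> 'a poly \<Rightarrow> 'a^'n \<Rightarrow> 'a^'n" where
  "poly_action T p v = (\<Sum>i\<le>degree p. coeff p i *s (((*v) T ^^ i) v))"

lemma poly_action_eq_sum:
  assumes "degree p \<le> N"
  shows "poly_action T p v = (\<Sum>i\<le>N. coeff p i *s (((*v) T ^^ i) v))"
  unfolding poly_action_def
  by (rule sum.mono_neutral_left) (use assms in \<open>auto simp: coeff_eq_0\<close>)

lemma matrix_vector_scale: "T *v (c *s v) = c *s (T *v v)" for T :: "('a::field)^'n^'n"
  by (rule vec.linear_scale[OF matrix_vector_mul_linear_gen])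

lemma matrix_funpow_diff: "((*v) T ^^ i) (v - w) = ((*v) T ^^ i) v - ((*v) T ^^ i) w"
  for T :: "('a::field)^'n^'n"
  by (induction i) (simp_all add: matrix_vector_mult_diff_distrib)

lemma matrix_funpow_scale: "((*v) T ^^ i) (c *s v) = c *s ((*v) T ^^ i) v"
  for T :: "('a::field)^'n^'n"
  by (induction i) (simp_all add: matrix_vector_scale)

text \<open>This lets one strip the linear factors of a complex polynomial one after the other, trading
  \<open>T - z\<close> in the polynomial for \<open>T - z\<close> applied to the vector.\<close>

lemma poly_action_linear_factor:
  "poly_action T ([:- z, 1:] * q) v = poly_action T q (T *v v - z *s v)"
proof -
  define N where "N = degree q"
  let ?P = "\<lambda>i. ((*v) T ^^ i) v"
  have deg: "degree ([:- z, 1:] * q) \<le> Suc N"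
    using degree_mult_le[of "[:- z, 1:]" q] by (simp add: N_def)
  have "(\<Sum>i\<le>Suc N. coeff ([:- z, 1:] * q) i *s ?P i)
      = (\<Sum>i\<le>Suc N. coeff (pCons 0 q) i *s ?P i) - (\<Sum>i\<le>Suc N. (z * coeff q i) *s ?P i)"
    by (simp add: sum_subtractf[symmetric] algebra_simps vector_sadd_rdistrib[symmetric]
        del: sum.atMost_Suc vector_sadd_rdistrib)
  also have "(\<Sum>i\<le>Suc N. coeff (pCons 0 q) i *s ?P i) = (\<Sum>i\<le>N. coeff q i *s ?P (Suc i))"
    by (subst sum.atMost_Suc_shift) simp
  also have "(\<Sum>i\<le>Suc N. (z * coeff q i) *s ?P i) = (\<Sum>i\<le>N. (z * coeff q i) *s ?P i)"
    by (simp add: N_def coeff_eq_0)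
  also have "(\<Sum>i\<le>N. coeff q i *s ?P (Suc i)) - (\<Sum>i\<le>N. (z * coeff q i) *s ?P i)
      = (\<Sum>i\<le>N. coeff q i *s (((*v) T ^^ i) (T *v v - z *s v)))"
    by (simp add: sum_subtractf[symmetric] matrix_funpow_diff matrix_funpow_scale
        vector_ssub_ldistrib vector_smult_assoc mult.commute funpow_swap1)
  finally show ?thesis
    unfolding poly_action_eq_sum[OF deg] by (simp add: poly_action_def N_def)
qed

lemma poly_action_diff: "poly_action T p (v - w) = poly_action T p v - poly_action T p w"
  by (simp add: poly_action_def matrix_funpow_diff vector_ssub_ldistrib sum_subtractf)

lemma poly_action_scale: "poly_action T p (c *s v) = c *s poly_action T p v"
  by (simp add: poly_action_def matrix_funpow_scale vec.scale_sum_right mult.commute)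

lemma poly_action_commute: "poly_action T p (T *v v) = T *v poly_action T p v"
  by (simp add: poly_action_def funpow_swap1[symmetric] matrix_vector_scale
      vec.linear_sum[OF matrix_vector_mul_linear_gen])

lemma poly_action_degree_0: "degree p = 0 \<Longrightarrow> poly_action T p v = coeff p 0 *s v"
  by (simp add: poly_action_def)

definition annihilates :: "('a::field)^'n^'n \<Rightarrow> 'a poly \<Rightarrow> bool" where
  "annihilates T p \<longleftrightarrow> p \<noteq> 0 \<and> (\<forall>v. poly_action T p v = 0)"

text \<open>The powers of \<open>T\<close> lie in a space of finite dimension and are therefore linearly dependent.\<close>

lemma exists_annihilating_poly:
  fixes T :: "complex^'n^'n"
  shows "\<exists>p. annihilates T p"
proof -
  define P where "P i = ((**) T ^^ i) (mat 1)" for i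
  define N where "N = DIM(complex^'n^'n)"
  obtain c i0 where c: "i0 \<le> N" "c i0 \<noteq> 0" "(\<Sum>i\<le>N. c i *\<^sub>R P i) = 0"
    using exists_linear_relation_seq[of P] by (auto simp: N_def)
  define p where "p = (\<Sum>i\<le>N. monom (complex_of_real (c i)) i)"
  have coeff_p: "coeff p i = (if i \<le> N then of_real (c i) else 0)" for i
    by (simp add: p_def coeff_sum if_distrib[of "\<lambda>x. x = _"] cong: if_cong)
  then have deg: "degree p \<le> N" by (intro degree_le) auto
  have P: "P i *v v = ((*v) T ^^ i) v" for i v
    by (induction i) (simp_all add: P_def matrix_vector_mul_assoc[symmetric])
  have "poly_action T p v = 0" for v
  proof -
    have "poly_action T p v = (\<Sum>i\<le>N. complex_of_real (c i) *s (P i *v v))"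
      unfolding poly_action_eq_sum[OF deg] by (simp add: coeff_p P)
    also have "\<dots> = (\<Sum>i\<le>N. c i *\<^sub>R P i) *v v"
    proof (intro vec_eq_iff[THEN iffD2] allI)
      fix j
      have "(\<Sum>i\<le>N. complex_of_real (c i) *s (P i *v v)) $ j
          = (\<Sum>i\<le>N. \<Sum>l\<in>UNIV. (c i *\<^sub>R P i $ j $ l) * v $ l)"
        by (simp add: matrix_vector_mult_def sum_distrib_left scaleR_conv_of_real mult.assoc)
      also have "\<dots> = ((\<Sum>i\<le>N. c i *\<^sub>R P i) *v v) $ j"
        by (subst sum.swap) (simp add: matrix_vector_mult_def sum_distrib_right)
      finally show "(\<Sum>i\<le>N. complex_of_real (c i) *s (P i *v v)) $ j
          = ((\<Sum>i\<le>N. c i *\<^sub>R P i) *v v) $ j" .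
    qed
    finally show ?thesis using c(3) by simp
  qed
  moreover have "p \<noteq> 0" using c coeff_p[of i0] by auto
  ultimately show ?thesis by (auto simp: annihilates_def)
qed

definition eigenvalues :: "('a::field)^'n^'n \<Rightarrow> 'a set" where
  "eigenvalues T = {z. \<exists>v. v \<noteq> 0 \<and> T *v v = z *s v}"

lemma funpow_eigenvector:
  fixes T :: "('a::field)^'n^'n"
  assumes "T *v v = z *s v"
  shows "((*v) T ^^ i) v = z ^ i *s v"
  by (induction i) (simp_all add: assms matrix_vector_scale vector_smult_assoc mult.commute)

lemma finite_eigenvalues:
  fixes T :: "complex^'n^'n"
  shows "finite (eigenvalues T)"
proof -
  obtain p where p: "annihilates T p" using exists_annihilating_poly by blast
  have "eigenvalues T \<subseteq> {z. poly p z = 0}"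
  proof
    fix z assume "z \<in> eigenvalues T"
    then obtain v where v: "v \<noteq> 0" "T *v v = z *s v" by (auto simp: eigenvalues_def)
    have "poly_action T p v = poly p z *s v"
      by (simp add: poly_action_def funpow_eigenvector[OF v(2)] poly_altdef vec_eq_iff
          sum_distrib_right mult.assoc)
    with p v(1) show "z \<in> {z. poly p z = 0}" by (auto simp: annihilates_def vector_mul_eq_0)
  qed
  then show ?thesis using p finite_subset poly_roots_finite by (auto simp: annihilates_def)
qed

text \<open>If \<open>z\<close> is not an eigenvalue, then \<open>T - z\<close> is injective, and the factor belonging to \<open>z\<close> can be
  dropped from any polynomial that annihilates \<open>v\<close>.\<close>

lemma cancel_non_eigenvalue_factor:
  fixes T :: "complex^'n^'n"
  assumes "z \<notin> eigenvalues T" "poly_action T ([:- z, 1:] * q) v = 0"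
  shows "poly_action T q v = 0"
proof -
  have "T *v poly_action T q v = z *s poly_action T q v"
    using assms(2) unfolding poly_action_linear_factor
    by (simp add: poly_action_diff poly_action_scale poly_action_commute)
  with assms(1) show ?thesis by (auto simp: eigenvalues_def)
qed

lemma complex_poly_linear_factor:
  fixes p :: "complex poly"
  assumes "degree p = Suc d"
  obtains z q where "p = [:- z, 1:] * q" "degree q = d" "q \<noteq> 0"
proof -
  have "\<not> constant (poly p)" using assms by (simp add: constant_degree)
  then obtain z where "poly p z = 0" using fundamental_theorem_of_algebra by blast
  then obtain q where q: "p = [:- z, 1:] * q" by (auto simp: poly_eq_0_iff_dvd)
  with assms have "q \<noteq> 0" by auto
  moreover from this q assms have "degree q = d" using degree_mult_eq[of "[:- z, 1:]" q] by simp
  ultimately show thesis using that q by blast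
qed

text \<open>Without eigenvalues, every linear factor of an annihilating polynomial could be dropped, so that a
  nonzero constant would annihilate all vectors.\<close>

lemma eigenvalues_nonempty:
  fixes T :: "complex^'n^'n"
  shows "eigenvalues T \<noteq> {}"
proof
  assume empty: "eigenvalues T = {}"
  have zero: "v = 0" if "degree p = d" "p \<noteq> 0" "poly_action T p v = 0" for p d v
    using that
  proof (induction d arbitrary: p)
    case 0
    then have "coeff p 0 \<noteq> 0" using leading_coeff_0_iff[of p] by simp
    with 0 show ?case by (simp add: poly_action_degree_0 vector_mul_eq_0)
  next
    case (Suc d)
    obtain z q where q: "p = [:- z, 1:] * q" "degree q = d" "q \<noteq> 0"
      using complex_poly_linear_factor[OF Suc.prems(1)] .
    show ?case
      using Suc.IH[OF q(2,3)] cancel_non_eigenvalue_factor[of z T q v] Suc.prems(3) q(1) empty by simp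
  qed
  obtain p where "annihilates T p" using exists_annihilating_poly by blast
  then have "(vec 1 :: complex^'n) = 0" 
    using zero[OF refl, of p "vec 1"] by (simp add: annihilates_def)
  then show False by (simp add: vec_eq_iff)
qed

lemma norm_vector_scale: "norm (z *s v) = cmod z * norm v" for v :: "complex^'n"
  by (simp add: norm_vec_def L2_set_def norm_mult power_mult_distrib sum_distrib_left[symmetric]
      real_sqrt_mult)

text \<open>The step that handles one eigenvalue: \<open>u\<close> solves \<open>u(k+1) = z u(k) + e(k)\<close> with an error of order
  \<open>r\<^sup>k\<close>, and as \<open>\<bar>z\<bar> < r\<close> the solution has the same order.\<close>

lemma geometric_recursion_bound:
  fixes u :: "nat \<Rightarrow> complex^'n"
  assumes z: "cmod z < r" and step: "\<And>k. norm (u (Suc k) - z *s u k) \<le> C * r ^ k"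
  shows "\<exists>C. \<forall>k. norm (u k) \<le> C * r ^ k"
proof -
  have r: "0 < r" using z norm_ge_zero[of z] by linarith
  \<comment> \<open>The bound propagates from \<open>k\<close> to \<open>k + 1\<close> exactly when \<open>\<bar>z\<bar> K + C \<le> r K\<close>.\<close>
  define K where "K = max (norm (u 0)) (C / (r - cmod z))"
  have "C / (r - cmod z) \<le> K" by (simp add: K_def)
  then have CK: "cmod z * K + C \<le> r * K"
    using z by (simp add: field_simps)
  have "norm (u k) \<le> K * r ^ k" for k
  proof (induction k)
    case 0
    then show ?case by (simp add: K_def)
  next
    case (Suc k)
    have "norm (u (Suc k)) \<le> cmod z * norm (u k) + norm (u (Suc k) - z *s u k)"
      using norm_triangle_ineq[of "z *s u k" "u (Suc k) - z *s u k"] by (simp add: norm_vector_scale)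
    also have "\<dots> \<le> cmod z * (K * r ^ k) + C * r ^ k"
      by (intro add_mono mult_left_mono Suc step) simp
    also have "\<dots> = (cmod z * K + C) * r ^ k" by (simp add: algebra_simps)
    also have "\<dots> \<le> (r * K) * r ^ k" using CK r by (intro mult_right_mono) auto
    finally show ?case by (simp add: algebra_simps)
  qed
  then show ?thesis by blast
qed

text \<open>Induction on the degree of a polynomial annihilating \<open>v\<close>. Removing a factor \<open>x - z\<close> bounds the orbit
  of \<open>T v - z v\<close>, that is, the error \<open>T\<^sup>k\<^sup>+\<^sup>1 v - z T\<^sup>k v\<close>; if \<open>z\<close> is an eigenvalue, the scalar recursion
  transfers this to the orbit of \<open>v\<close>, and otherwise the factor can simply be dropped. This replaces
  a Jordan normal form.\<close>

lemma matrix_orbit_decay: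
  fixes T :: "complex^'n^'n"
  assumes spec: "\<And>z. z \<in> eigenvalues T \<Longrightarrow> cmod z < r"
  shows "\<exists>C. \<forall>k. norm (((*v) T ^^ k) v) \<le> C * r ^ k"
proof -
  have main: "\<exists>C. \<forall>k. norm (((*v) T ^^ k) v) \<le> C * r ^ k"
    if "degree p = d" "p \<noteq> 0" "poly_action T p v = 0" for p d v
    using that
  proof (induction d arbitrary: p v)
    case 0
    then have "coeff p 0 \<noteq> 0" using leading_coeff_0_iff[of p] by simp
    with 0 have v: "v = 0" by (simp add: poly_action_degree_0 vector_mul_eq_0)
    have "((*v) T ^^ k) 0 = 0" for k by (induction k) simp_all
    then show ?case unfolding v by (intro exI[of _ 0]) simp
  next
    case (Suc d)
    obtain z q where q: "p = [:- z, 1:] * q" "degree q = d" "q \<noteq> 0"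
      using complex_poly_linear_factor[OF Suc.prems(1)] .
    show ?case
    proof (cases "z \<in> eigenvalues T")
      case True
      have "poly_action T q (T *v v - z *s v) = 0"
        using Suc.prems(3) by (simp add: q(1) poly_action_linear_factor del: mult_pCons_left)
      from Suc.IH[OF q(2,3) this] obtain C
        where "\<And>k. norm (((*v) T ^^ k) (T *v v - z *s v)) \<le> C * r ^ k" by blast
      then have "norm (((*v) T ^^ Suc k) v - z *s ((*v) T ^^ k) v) \<le> C * r ^ k" for k
        by (simp add: matrix_funpow_diff matrix_funpow_scale funpow_swap1)
      with spec[OF True] show ?thesis by (rule geometric_recursion_bound)
    next
      case False
      then show ?thesis
        using Suc.IH[OF q(2,3)] cancel_non_eigenvalue_factor[of z T q v] Suc.prems(3) q(1) by simp
    qed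
  qed
  obtain p where "annihilates T p" using exists_annihilating_poly by blast
  then show ?thesis using main[OF refl, of p v] by (simp add: annihilates_def)
qed

lemma complex_eigenvalues_eq:
  "complex_eigenvalues A = eigenvalues (map_matrix complex_of_real A)"
  by (simp add: complex_eigenvalues_def eigenvalues_def)

text \<open>The maximum defining the spectral radius behaves as expected because the spectrum is finite and
  nonempty.\<close>

lemma schur_stable_iff: "schur_stable A \<longleftrightarrow> (\<forall>z\<in>complex_eigenvalues A. cmod z < 1)"
  unfolding schur_stable_def real_spectral_radius_def complex_eigenvalues_eq
  by (subst Max_less_iff) (auto simp: finite_eigenvalues eigenvalues_nonempty)

definition complex_vec :: "real^'n \<Rightarrow> complex^'n" where
  "complex_vec v = (\<chi> i. complex_of_real (v $ i))"

lemma norm_complex_vec: "norm (complex_vec v) = norm v"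
  by (simp add: complex_vec_def norm_vec_def)

lemma complex_vec_matrix_vector:
  "map_matrix complex_of_real H *v complex_vec v = complex_vec (H *v v)"
  by (simp add: complex_vec_def map_matrix_def matrix_vector_mult_def vec_eq_iff)

lemma complex_vec_funpow:
  fixes H :: "real^'n^'n"
  shows
  "((*v) (map_matrix complex_of_real H) ^^ k) (complex_vec v) = complex_vec (((*v) H ^^ k) v)"
  by (induction k) (simp_all add: complex_vec_matrix_vector)

lemma linear_matrix_funpow: "linear ((*v) H ^^ k)" for H :: "real^'n^'n"
proof (induction k)
  case 0
  show ?case by (simp add: linear_iff)
next
  case (Suc k)
  then show ?case using linear_compose[OF Suc matrix_vector_mul_linear[of H]] by (simp add: o_def)
qed

text \<open>Any \<open>r\<close> strictly between the spectral radius and 1 works. The constants obtained for the unit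
  vectors add up to one that is uniform in \<open>v\<close>.\<close>

lemma schur_stable_geometric:
  fixes H :: "real^'n^'n"
  assumes "schur_stable H"
  obtains r C where "0 < r" "r < 1" "\<forall>k v. norm (((*v) H ^^ k) v) \<le> C * r ^ k * norm v"
proof -
  define r where "r = (1 + real_spectral_radius H) / 2"
  let ?E = "cmod ` complex_eigenvalues H"
  have fin: "finite ?E" and ne: "?E \<noteq> {}"
    by (simp_all add: complex_eigenvalues_eq finite_eigenvalues eigenvalues_nonempty)
  have \<rho>: "real_spectral_radius H < 1" using assms by (simp add: schur_stable_def)
  have le: "x \<le> real_spectral_radius H" if "x \<in> ?E" for x
    unfolding real_spectral_radius_def using fin that by simp
  obtain x where "x \<in> ?E" using ne by blast
  with le[OF this] have "0 \<le> real_spectral_radius H" by (auto intro: order_trans[OF norm_ge_zero])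
  with \<rho> have r: "0 < r" "r < 1" "real_spectral_radius H < r" by (simp_all add: r_def)
  have "cmod z < r" if "z \<in> eigenvalues (map_matrix complex_of_real H)" for z
    using le[of "cmod z"] r(3) that by (auto simp: complex_eigenvalues_eq)
  from matrix_orbit_decay[OF this] have "\<exists>C. \<forall>k. norm (((*v) H ^^ k) v) \<le> C * r ^ k" for v
    using complex_vec_funpow[where H = H and v = v] norm_complex_vec by metis
  then obtain C where C: "\<And>v k. norm (((*v) H ^^ k) v) \<le> C v * r ^ k" by metis
  have "norm (((*v) H ^^ k) v) \<le> (\<Sum>i\<in>UNIV. C (axis i 1)) * r ^ k * norm v" for k v
  proof -
    interpret linear "(*v) H ^^ k" by (rule linear_matrix_funpow)
    have "v = (\<Sum>i\<in>UNIV. v $ i *\<^sub>R axis i 1)"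
      by (simp add: basis_expansion scalar_mult_eq_scaleR[symmetric])
    then have "((*v) H ^^ k) v = (\<Sum>i\<in>UNIV. v $ i *\<^sub>R ((*v) H ^^ k) (axis i 1))"
      by (metis (no_types, lifting) sum sum.cong scale)
    also have "norm \<dots> \<le> (\<Sum>i\<in>UNIV. norm v * (C (axis i 1) * r ^ k))"
      by (rule sum_norm_le) (auto intro!: mult_mono C component_le_norm_cart)
    finally show ?thesis by (simp add: sum_distrib_left sum_distrib_right mult.commute)
  qed
  with r show thesis using that by blast
qed

text \<open>For a complex eigenvector \<open>v\<close> with eigenvalue \<open>z\<close>, the vectors \<open>z\<^sup>k v\<close> are combinations of the
  orbits of the real and imaginary parts of \<open>v\<close>, so they tend to 0.\<close>

lemma schur_stable_if_orbits_vanish: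
  fixes H :: "real^'n^'n"
  assumes lim: "\<And>v. (\<lambda>k. ((*v) H ^^ k) v) \<longlonglongrightarrow> 0"
  shows "schur_stable H"
  unfolding schur_stable_iff
proof
  let ?H = "map_matrix complex_of_real H"
  fix z assume "z \<in> complex_eigenvalues H"
  then obtain v where v: "v \<noteq> 0" "?H *v v = z *s v"
    by (auto simp: complex_eigenvalues_def)
  define u w where "u = (\<chi> i. Re (v $ i))" and "w = (\<chi> i. Im (v $ i))"
  have split: "v = complex_vec u + \<i> *s complex_vec w"
    by (simp add: vec_eq_iff u_def w_def complex_vec_def complex_eq)
  have le: "norm (z ^ k *s v) \<le> norm (((*v) H ^^ k) u) + norm (((*v) H ^^ k) w)" for k
  proof -
    have "v = complex_vec u - (- \<i>) *s complex_vec w" using split by simp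
    then have "z ^ k *s v = complex_vec (((*v) H ^^ k) u) - (- \<i>) *s complex_vec (((*v) H ^^ k) w)"
      using funpow_eigenvector[OF v(2), of k]
      by (metis complex_vec_funpow matrix_funpow_diff matrix_funpow_scale)
    then show ?thesis
      using norm_triangle_ineq4[of "complex_vec (((*v) H ^^ k) u)"
          "(- \<i>) *s complex_vec (((*v) H ^^ k) w)"]
      by (simp only: norm_vector_scale norm_complex_vec) simp
  qed
  have lim0: "(\<lambda>k. norm (((*v) H ^^ k) u) + norm (((*v) H ^^ k) w)) \<longlonglongrightarrow> 0"
    using tendsto_add[OF tendsto_norm[OF lim[of u]] tendsto_norm[OF lim[of w]]] by simp
  have "(\<lambda>k. cmod z ^ k * norm v) \<longlonglongrightarrow> 0"
    by (rule Lim_null_comparison[OF _ lim0])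
      (use le in \<open>simp add: norm_vector_scale norm_power\<close>)
  then have "(\<lambda>k. cmod z ^ k * norm v / norm v) \<longlonglongrightarrow> 0 / norm v"
    by (rule tendsto_divide) (use v in auto)
  then have *: "(\<lambda>k. cmod z ^ k) \<longlonglongrightarrow> 0" using v(1) by simp
  show "cmod z < 1"
  proof (rule ccontr)
    assume "\<not> cmod z < 1"
    then have "1 \<le> cmod z ^ k" for k by (intro one_le_power) simp
    with LIMSEQ_le_const[OF *, of 1] show False by auto
  qed
qed

lemma schur_stable_orbit_tendsto:
  assumes "schur_stable H"
  shows "(\<lambda>k. ((*v) H ^^ k) v) \<longlonglongrightarrow> 0"
proof -
  obtain r C where r: "0 < r" "r < 1" and C: "\<forall>k v. norm (((*v) H ^^ k) v) \<le> C * r ^ k * norm v"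
    using schur_stable_geometric[OF assms] .
  have "(\<lambda>k. C * r ^ k * norm v) \<longlonglongrightarrow> C * 0 * norm v"
    by (intro tendsto_intros LIMSEQ_realpow_zero) (use r in auto)
  then have "(\<lambda>k. C * r ^ k * norm v) \<longlonglongrightarrow> 0" by simp
  then show ?thesis by (rule Lim_null_comparison[rotated]) (use C in simp)
qed

text \<open>A vector in the kernel of \<open>I - H\<close> is fixed by all powers of \<open>H\<close>, which tend to 0.\<close>

lemma schur_stable_invertible:
  fixes H :: "real^'n^'n"
  assumes "schur_stable H"
  shows "invertible (mat 1 - H)"
proof -
  have "v = 0" if "(mat 1 - H) *v v = 0" for v
  proof -
    have Hv: "H *v v = v" using that by (simp add: matrix_vector_mult_diff_rdistrib)
    have "((*v) H ^^ k) v = v" for k by (induction k) (simp_all add: Hv)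
    then show ?thesis
      using schur_stable_orbit_tendsto[OF assms, of v] by (simp add: LIMSEQ_const_iff)
  qed
  then show ?thesis
    by (simp add: invertible_left_inverse matrix_left_invertible_ker)
qed

lemma convergent_vec:
  fixes u :: "nat \<Rightarrow> ('a::real_normed_vector)^'m"
  assumes "\<And>i. convergent (\<lambda>k. u k $ i)"
  shows "convergent u"
proof -
  obtain L where "\<And>i. (\<lambda>k. u k $ i) \<longlonglongrightarrow> L i" using assms unfolding convergent_def by metis
  then have "u \<longlonglongrightarrow> (\<chi> i. L i)" by (intro vec_tendstoI) auto
  then show ?thesis by (rule convergentI)
qed

text \<open>Here \<open>b k j\<close> is the input that at time \<open>k\<close> is \<open>j\<close> steps old. Its weight \<open>H\<^sup>j\<close> is summable in norm,
  so Tannery's theorem, applied to each component, reduces the convergence of the whole sum to that of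
  the inputs of each fixed age.\<close>

lemma convergent_weighted_history:
  fixes H :: "real^'n^'n" and b :: "nat \<Rightarrow> nat \<Rightarrow> real^'n"
  assumes stable: "schur_stable H"
    and bound: "\<And>k j. norm (b k j) \<le> F"
    and lim: "\<And>j. (\<lambda>k. b k j) \<longlonglongrightarrow> \<beta> j"
  shows "convergent (\<lambda>k. \<Sum>j<k. ((*v) H ^^ j) (b k j))"
proof -
  obtain r C where r: "0 < r" "r < 1" and C': "\<forall>k v. norm (((*v) H ^^ k) v) \<le> C * r ^ k * norm v"
    using schur_stable_geometric[OF stable] .
  note C = C'[rule_format]
  have F: "0 \<le> F" using bound[of 0 0] norm_ge_zero order_trans by blast
  have C0: "0 \<le> C"
    using C[of 0 "axis undefined 1"] norm_ge_zero[of "axis undefined 1 :: real^'n"]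
    by simp
  have comp: "\<exists>L. (\<lambda>k. (\<Sum>j<k. ((*v) H ^^ j) (b k j)) $ i) \<longlonglongrightarrow> L" for i
  proof -
    \<comment> \<open>Extended by 0 beyond \<open>k\<close>, so that the finite sums become series with a fixed index range.\<close>
    define t where "t j k = (if j < k then ((*v) H ^^ j) (b k j) $ i else 0)" for j k
    have t_lim: "(\<lambda>k. t j k) \<longlonglongrightarrow> ((*v) H ^^ j) (\<beta> j) $ i" for j
    proof (rule Lim_transform_eventually)
      show "(\<lambda>k. ((*v) H ^^ j) (b k j) $ i) \<longlonglongrightarrow> ((*v) H ^^ j) (\<beta> j) $ i"
        by (intro tendsto_vec_nth bounded_linear.tendsto[OF _ lim]
            linear_conv_bounded_linear[THEN iffD1] linear_matrix_funpow)
      show "\<forall>\<^sub>F k in sequentially. ((*v) H ^^ j) (b k j) $ i = t j k"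
        using eventually_gt_at_top[of j] by eventually_elim (simp add: t_def)
    qed
    have t_bound: "norm (t j k) \<le> C * F * r ^ j" for j k
    proof (cases "j < k")
      case True
      have "norm (t j k) \<le> norm (((*v) H ^^ j) (b k j))"
        using True component_le_norm_cart by (simp add: t_def)
      also have "\<dots> \<le> C * r ^ j * norm (b k j)" by (rule C)
      also have "\<dots> \<le> C * r ^ j * F" using r C0 by (intro mult_left_mono bound) auto
      finally show ?thesis by (simp add: mult_ac)
    next
      case False
      then show ?thesis using C0 F r by (simp add: t_def)
    qed
    have "(\<lambda>k. \<Sum>j. t j k) \<longlonglongrightarrow> (\<Sum>j. ((*v) H ^^ j) (\<beta> j) $ i)"
    proof (rule tannerys_theorem[THEN conjunct2, THEN conjunct2])
      show "\<forall>\<^sub>F (j, k) in at_top \<times>\<^sub>F sequentially. norm (t j k) \<le> C * F * r ^ j"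
        using t_bound by (intro always_eventually) auto
      show "summable (\<lambda>j. C * F * r ^ j)" by (intro summable_mult summable_geometric) (use r in auto)
    qed (use t_lim in auto)
    moreover have "(\<Sum>j. t j k) = (\<Sum>j<k. ((*v) H ^^ j) (b k j)) $ i" for k
    proof -
      have "(\<Sum>j. t j k) = (\<Sum>j<k. t j k)" by (rule suminf_finite) (auto simp: t_def)
      then show ?thesis by (simp add: t_def)
    qed
    ultimately show ?thesis by auto
  qed
  show ?thesis by (rule convergent_vec) (use comp in \<open>simp add: convergent_def\<close>)
qed

section \<open>Two-time laws of a finite chain\<close>

lemma (in prob_space) prob_partition:
  assumes "finite I" "\<And>\<omega>. \<omega> \<in> space M \<Longrightarrow> Q \<omega> \<Longrightarrow> Y \<omega> \<in> I"
    and "\<And>i. i \<in> I \<Longrightarrow> {\<omega> \<in> space M. Q \<omega> \<and> Y \<omega> = i} \<in> events"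
  shows "\<P>(\<omega> in M. Q \<omega>) = (\<Sum>i\<in>I. \<P>(\<omega> in M. Q \<omega> \<and> Y \<omega> = i))"
proof -
  have "{\<omega> \<in> space M. Q \<omega>} = (\<Union>i\<in>I. {\<omega> \<in> space M. Q \<omega> \<and> Y \<omega> = i})"
    using assms(2) by blast
  also have "prob \<dots> = (\<Sum>i\<in>I. \<P>(\<omega> in M. Q \<omega> \<and> Y \<omega> = i))"
    using assms by (intro finite_measure_finite_Union) (auto simp: disjoint_family_on_def)
  finally show ?thesis .
qed

lemma (in prob_space) integrable_simple_function:
  fixes f :: "'a \<Rightarrow> 'b::{banach, second_countable_topology}"
  assumes "simple_function M f"
  shows "integrable M f"
proof (rule integrable_const_bound)
  have "finite (norm ` f ` space M)" using assms by (simp add: simple_functionD)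
  then show "AE \<omega> in M. norm (f \<omega>) \<le> Max (norm ` f ` space M)" by auto
  show "f \<in> borel_measurable M" using assms by (rule borel_measurable_simple_function)
qed

lemma (in prob_space) expectation_finite_range:
  fixes g :: "'c \<Rightarrow> 'b::{banach, second_countable_topology}"
  assumes Y: "simple_function M Y" and I: "finite I" "\<And>\<omega>. \<omega> \<in> space M \<Longrightarrow> Y \<omega> \<in> I"
  shows "(\<integral>\<omega>. g (Y \<omega>) \<partial>M) = (\<Sum>i\<in>I. \<P>(\<omega> in M. Y \<omega> = i) *\<^sub>R g i)"
proof -
  let ?E = "\<lambda>i. {\<omega> \<in> space M. Y \<omega> = i}"
  have E: "?E i \<in> events" for i
    using simple_functionD(2)[OF Y, of "{i}"] by (simp add: vimage_def Int_def conj_commute)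
  have "(\<integral>\<omega>. g (Y \<omega>) \<partial>M) = (\<integral>\<omega>. (\<Sum>i\<in>I. indicator (?E i) \<omega> *\<^sub>R g i) \<partial>M)"
  proof (rule Bochner_Integration.integral_cong[OF refl])
    fix \<omega> assume \<omega>: "\<omega> \<in> space M"
    have "(\<Sum>i\<in>I. indicator (?E i) \<omega> *\<^sub>R g i) = (\<Sum>i\<in>{Y \<omega>}. indicator (?E i) \<omega> *\<^sub>R g i)"
      by (rule sum.mono_neutral_right) (use I \<omega> in \<open>auto simp: indicator_def\<close>)
    also have "\<dots> = g (Y \<omega>)" using \<omega> by simp
    finally show "g (Y \<omega>) = (\<Sum>i\<in>I. indicator (?E i) \<omega> *\<^sub>R g i)" by simp
  qed
  also have "\<dots> = (\<Sum>i\<in>I. \<integral>\<omega>. indicator (?E i) \<omega> *\<^sub>R g i \<partial>M)"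
    by (intro Bochner_Integration.integral_sum integrable_scaleR_left
        integrable_real_indicator E) (simp add: emeasure_eq_measure)
  also have "\<dots> = (\<Sum>i\<in>I. \<P>(\<omega> in M. Y \<omega> = i) *\<^sub>R g i)"
    using E by (intro sum.cong refl) (simp add: emeasure_eq_measure)
  finally show ?thesis .
qed

locale finite_markov_chain =
  fixes S :: "'s set" and p :: "'s \<Rightarrow> 's \<Rightarrow> real" and \<pi>0 :: "'s \<Rightarrow> real"
    and M :: "'w measure" and X :: "nat \<Rightarrow> 'w \<Rightarrow> 's"
  assumes finite_states: "finite S" and chain: "markov_chain_on S p \<pi>0 M X"
begin

lemma prob_space_M: "prob_space M"
  and initial_distribution: "distribution_on S \<pi>0"
  and state_measurable: "X k \<in> measurable M (count_space S)"
  and initial_law: "s \<in> S \<Longrightarrow> \<P>(\<omega> in M. X 0 \<omega> = s) = \<pi>0 s"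
  using chain unfolding markov_chain_on_def by blast+

sublocale prob_space M
  by (rule prob_space_M)

lemma state_in: "\<omega> \<in> space M \<Longrightarrow> X k \<omega> \<in> S"
  using measurable_space[OF state_measurable] by simp

lemma simple_state: "simple_function M (X k)"
  unfolding simple_function_def
proof (intro conjI ballI)
  show "finite (X k ` space M)"
    using finite_states state_in by (metis finite_subset image_subsetI)
  fix x assume "x \<in> X k ` space M"
  then have "{x} \<in> sets (count_space S)" using state_in by auto
  then show "X k -` {x} \<inter> space M \<in> events"
    by (rule measurable_sets[OF state_measurable])
qed

lemma measurable_state [measurable]: "X k \<in> measurable M (count_space UNIV)"
  by (rule measurable_simple_function[OF simple_state])

text \<open>The product form of the Markov property; it also covers histories of probability 0, where both
  sides vanish.\<close>

lemma prob_history_step: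
  assumes h: "\<And>i. i \<le> k \<Longrightarrow> h i \<in> S" and t: "t \<in> S"
  shows "\<P>(\<omega> in M. (\<forall>i\<le>k. X i \<omega> = h i) \<and> X (Suc k) \<omega> = t)
      = \<P>(\<omega> in M. \<forall>i\<le>k. X i \<omega> = h i) * p (h k) t" (is "?L = ?R * _")
proof (cases "0 < ?R")
  case True
  then have "\<P>(\<omega> in M. X (Suc k) \<omega> = t \<bar> \<forall>i\<le>k. X i \<omega> = h i) = p (h k) t"
    using chain h t unfolding markov_chain_on_def by blast
  with True show ?thesis by (simp add: cond_prob_def field_simps conj_commute)
next
  case False
  then have R: "?R = 0" by (simp only: zero_less_measure_iff not_not)
  have "?L \<le> ?R"
    by (rule finite_measure_mono) (blast, measurable)
  then have "?L = 0" unfolding R using measure_nonneg by (rule order_antisym)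
  then show ?thesis unfolding R by simp
qed

text \<open>The Markov property is available only for complete histories. The event fixes the chain at times
  \<open>m\<close>, \<open>k\<close> and \<open>k + 1\<close>; it is split into the finitely many histories compatible with it, and for all
  of these the transition from \<open>k\<close> to \<open>k + 1\<close> contributes the same factor \<open>p l t\<close>.\<close>

lemma prob_three_times:
  assumes m: "m \<le> k" and l: "l \<in> S" and t: "t \<in> S"
  shows "\<P>(\<omega> in M. X m \<omega> = s \<and> X k \<omega> = l \<and> X (Suc k) \<omega> = t)
      = \<P>(\<omega> in M. X m \<omega> = s \<and> X k \<omega> = l) * p l t"
proof -
  define I where "I = {h \<in> {..k} \<rightarrow>\<^sub>E S. h m = s \<and> h k = l}"
  define Y where "Y \<omega> = restrict (\<lambda>i. X i \<omega>) {..k}" for \<omega>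
  have I: "finite I" unfolding I_def using finite_states by (simp add: finite_PiE)
  have Y_in: "Y \<omega> \<in> I" if "\<omega> \<in> space M" "X m \<omega> = s \<and> X k \<omega> = l" for \<omega>
    using that m state_in by (auto simp: Y_def I_def)
  have Y_eq: "Y \<omega> = h \<longleftrightarrow> (\<forall>i\<le>k. X i \<omega> = h i)" if "h \<in> I" for h \<omega>
    using that unfolding Y_def I_def by (auto simp: fun_eq_iff PiE_def extensional_def)
  have past: "X m \<omega> = s \<and> X k \<omega> = l \<and> Y \<omega> = h \<longleftrightarrow> (\<forall>i\<le>k. X i \<omega> = h i)"
    if "h \<in> I" for h \<omega>
    using Y_eq[OF that] that m by (auto simp: I_def)
  have now: "(X m \<omega> = s \<and> X k \<omega> = l \<and> X (Suc k) \<omega> = t) \<and> Y \<omega> = h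
      \<longleftrightarrow> (\<forall>i\<le>k. X i \<omega> = h i) \<and> X (Suc k) \<omega> = t" if "h \<in> I" for h \<omega>
    using past[OF that] by blast
  have hist: "{\<omega> \<in> space M. \<forall>i\<le>k. X i \<omega> = h i} \<in> events"
    "{\<omega> \<in> space M. (\<forall>i\<le>k. X i \<omega> = h i) \<and> X (Suc k) \<omega> = t} \<in> events" for h
    by measurable
  have "\<P>(\<omega> in M. X m \<omega> = s \<and> X k \<omega> = l \<and> X (Suc k) \<omega> = t)
      = (\<Sum>h\<in>I. \<P>(\<omega> in M. (X m \<omega> = s \<and> X k \<omega> = l \<and> X (Suc k) \<omega> = t) \<and> Y \<omega> = h))"
  proof (rule prob_partition[OF I])
    fix \<omega> assume "\<omega> \<in> space M" "X m \<omega> = s \<and> X k \<omega> = l \<and> X (Suc k) \<omega> = t"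
    then show "Y \<omega> \<in> I" using Y_in by blast
  qed (simp only: now hist)
  also have "\<dots> = (\<Sum>h\<in>I. \<P>(\<omega> in M. (\<forall>i\<le>k. X i \<omega> = h i) \<and> X (Suc k) \<omega> = t))"
    by (intro sum.cong refl) (simp only: now)
  also have "\<dots> = (\<Sum>h\<in>I. \<P>(\<omega> in M. \<forall>i\<le>k. X i \<omega> = h i) * p l t)"
  proof (rule sum.cong[OF refl])
    fix h assume "h \<in> I"
    then have "h i \<in> S" if "i \<le> k" for i using that by (auto simp: I_def)
    from prob_history_step[OF this t] \<open>h \<in> I\<close>
    show "\<P>(\<omega> in M. (\<forall>i\<le>k. X i \<omega> = h i) \<and> X (Suc k) \<omega> = t)
        = \<P>(\<omega> in M. \<forall>i\<le>k. X i \<omega> = h i) * p l t" by (simp add: I_def)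
  qed
  also have "\<dots> = (\<Sum>h\<in>I. \<P>(\<omega> in M. (X m \<omega> = s \<and> X k \<omega> = l) \<and> Y \<omega> = h)) * p l t"
    unfolding sum_distrib_right by (intro sum.cong refl) (simp only: past conj_assoc)
  also have "(\<Sum>h\<in>I. \<P>(\<omega> in M. (X m \<omega> = s \<and> X k \<omega> = l) \<and> Y \<omega> = h))
      = \<P>(\<omega> in M. X m \<omega> = s \<and> X k \<omega> = l)"
    by (rule prob_partition[OF I, symmetric]) (use Y_in hist in \<open>simp_all only: past conj_assoc\<close>)
  finally show ?thesis .
qed

lemma prob_two_times:
  assumes "s \<in> S" "t \<in> S"
  shows "\<P>(\<omega> in M. X m \<omega> = s \<and> X (m + d) \<omega> = t) = \<P>(\<omega> in M. X m \<omega> = s) * power_on S p d s t"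
  using assms(2)
proof (induction d arbitrary: t)
  case 0
  show ?case
  proof (cases "s = t")
    case True
    then show ?thesis by (simp add: conj_absorb)
  next
    case False
    then have empty: "{\<omega> \<in> space M. X m \<omega> = s \<and> X (m + 0) \<omega> = t} = {}" by auto
    from False show ?thesis unfolding empty by simp
  qed
next
  case (Suc d)
  have "\<P>(\<omega> in M. X m \<omega> = s \<and> X (m + Suc d) \<omega> = t)
      = (\<Sum>l\<in>S. \<P>(\<omega> in M. (X m \<omega> = s \<and> X (m + Suc d) \<omega> = t) \<and> X (m + d) \<omega> = l))"
    by (rule prob_partition[OF finite_states state_in]) measurable
  also have "\<dots> = (\<Sum>l\<in>S. \<P>(\<omega> in M. X m \<omega> = s \<and> X (m + d) \<omega> = l \<and> X (Suc (m + d)) \<omega> = t))"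
    by (simp add: conj_ac)
  also have "\<dots> = (\<Sum>l\<in>S. \<P>(\<omega> in M. X m \<omega> = s) * power_on S p d s l * p l t)"
    by (intro sum.cong refl) (simp add: prob_three_times Suc)
  finally show ?case by (simp add: sum_distrib_left mult.assoc)
qed

lemma prob_state:
  assumes t: "t \<in> S"
  shows "\<P>(\<omega> in M. X k \<omega> = t) = (\<Sum>s\<in>S. \<pi>0 s * power_on S p k s t)"
proof -
  have "\<P>(\<omega> in M. X k \<omega> = t) = (\<Sum>s\<in>S. \<P>(\<omega> in M. X k \<omega> = t \<and> X 0 \<omega> = s))"
    by (rule prob_partition[OF finite_states state_in]) measurable
  also have "\<dots> = (\<Sum>s\<in>S. \<P>(\<omega> in M. X 0 \<omega> = s \<and> X (0 + k) \<omega> = t))"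
    by (simp add: conj_commute)
  also have "\<dots> = (\<Sum>s\<in>S. \<pi>0 s * power_on S p k s t)"
    by (intro sum.cong refl) (simp only: prob_two_times[OF _ t] initial_law)
  finally show ?thesis .
qed

end

text \<open>The only property of irreducible aperiodic chains that the moment analysis relies on is the
  convergence of the rows of \<open>p\<^sup>k\<close> to a common limit \<open>\<pi>\<close>.\<close>

locale ergodic_finite_chain = finite_markov_chain S p \<pi>0 M X
  for S :: "'s set" and p \<pi>0 and M :: "'w measure" and X +
  fixes \<pi> :: "'s \<Rightarrow> real"
  assumes power_tendsto: "\<And>i j. i \<in> S \<Longrightarrow> j \<in> S \<Longrightarrow> (\<lambda>k. power_on S p k i j) \<longlonglongrightarrow> \<pi> j"
begin

lemma prob_state_tendsto:
  assumes t: "t \<in> S"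
  shows "(\<lambda>k. \<P>(\<omega> in M. X k \<omega> = t)) \<longlonglongrightarrow> \<pi> t"
proof -
  have "(\<lambda>k. \<Sum>s\<in>S. \<pi>0 s * power_on S p k s t) \<longlonglongrightarrow> (\<Sum>s\<in>S. \<pi>0 s * \<pi> t)"
    by (intro tendsto_intros power_tendsto t)
  moreover have "(\<Sum>s\<in>S. \<pi>0 s * \<pi> t) = \<pi> t"
    using initial_distribution by (simp add: distribution_on_def sum_distrib_right[symmetric])
  ultimately show ?thesis by (simp add: prob_state[OF t])
qed

lemma expectation_state_tendsto:
  fixes g :: "'s \<Rightarrow> 'b::{banach, second_countable_topology}"
  shows "(\<lambda>k. \<integral>\<omega>. g (X k \<omega>) \<partial>M) \<longlonglongrightarrow> (\<Sum>s\<in>S. \<pi> s *\<^sub>R g s)"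
proof -
  have "(\<integral>\<omega>. g (X k \<omega>) \<partial>M) = (\<Sum>s\<in>S. \<P>(\<omega> in M. X k \<omega> = s) *\<^sub>R g s)" for k
    by (rule expectation_finite_range[OF simple_state finite_states state_in])
  then show ?thesis by (auto intro!: tendsto_intros prob_state_tendsto)
qed

text \<open>By the two-time law, the joint distribution of \<open>X m\<close> and \<open>X (m + d)\<close> depends on \<open>m\<close> only through
  the law of \<open>X m\<close>, which tends to \<open>\<pi>\<close>.\<close>

lemma lagged_correlation_tendsto:
  fixes g :: "'s \<Rightarrow> 's \<Rightarrow> 'b::{banach, second_countable_topology}"
  shows "(\<lambda>m. \<integral>\<omega>. g (X m \<omega>) (X (m + d) \<omega>) \<partial>M)
    \<longlonglongrightarrow> (\<Sum>(s, t)\<in>S \<times> S. (\<pi> s * power_on S p d s t) *\<^sub>R g s t)"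
proof -
  have "(\<integral>\<omega>. g (X m \<omega>) (X (m + d) \<omega>) \<partial>M)
      = (\<Sum>(s, t)\<in>S \<times> S. (\<P>(\<omega> in M. X m \<omega> = s) * power_on S p d s t) *\<^sub>R g s t)" for m
  proof -
    have "(\<integral>\<omega>. case_prod g (X m \<omega>, X (m + d) \<omega>) \<partial>M)
        = (\<Sum>q\<in>S \<times> S. \<P>(\<omega> in M. (X m \<omega>, X (m + d) \<omega>) = q) *\<^sub>R case_prod g q)"
      by (rule expectation_finite_range)
        (auto simp: finite_states state_in intro: simple_state)
    then show ?thesis
      by (auto simp: prob_two_times intro!: sum.cong)
  qed
  moreover have "(\<lambda>m. \<Sum>q\<in>S \<times> S.
        (\<P>(\<omega> in M. X m \<omega> = fst q) * power_on S p d (fst q) (snd q)) *\<^sub>R g (fst q) (snd q))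
      \<longlonglongrightarrow> (\<Sum>q\<in>S \<times> S. (\<pi> (fst q) * power_on S p d (fst q) (snd q)) *\<^sub>R g (fst q) (snd q))"
    by (intro tendsto_intros prob_state_tendsto) auto
  ultimately show ?thesis by (simp add: case_prod_beta)
qed

text \<open>The form in which correlations occur in products of two trajectories: inputs of ages \<open>j\<close> and \<open>l\<close>
  seen from time \<open>k\<close>. Their distance in time is constant once \<open>k\<close> exceeds both ages.\<close>

lemma correlation_convergent:
  fixes g :: "'s \<Rightarrow> 's \<Rightarrow> 'b::{banach, second_countable_topology}"
  shows "convergent (\<lambda>k. \<integral>\<omega>. g (X (k - 1 - j) \<omega>) (X (k - 1 - l) \<omega>) \<partial>M)"
proof -
  have ordered: "convergent (\<lambda>k. \<integral>\<omega>. g (X (k - 1 - l) \<omega>) (X (k - 1 - j) \<omega>) \<partial>M)"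
    if "j \<le> l" for j l and g :: "'s \<Rightarrow> 's \<Rightarrow> 'b"
  proof -
    have lim: "filterlim (\<lambda>k. k - 1 - l) sequentially sequentially"
      using filterlim_minus_const_nat_at_top[of "Suc l"] by simp
    have "\<forall>\<^sub>F k in sequentially.
        (\<integral>\<omega>. g (X (k - 1 - l) \<omega>) (X (k - 1 - l + (l - j)) \<omega>) \<partial>M)
        = (\<integral>\<omega>. g (X (k - 1 - l) \<omega>) (X (k - 1 - j) \<omega>) \<partial>M)"
      using eventually_gt_at_top[of l] by eventually_elim (use that in simp)
    from Lim_transform_eventually[OF
        filterlim_compose[OF lagged_correlation_tendsto[of g "l - j"] lim] this]
    show ?thesis by (rule convergentI)
  qed
  show ?thesis
  proof (cases "j \<le> l")
    case True
    from ordered[OF this, of "\<lambda>s t. g t s"] show ?thesis .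
  next
    case False
    then show ?thesis using ordered[of l j g] by simp
  qed
qed

end

section \<open>Moments of the driven system\<close>

lemma trajectory_Suc:
  "trajectory B A W X x0 (Suc k) \<omega> = (B - A ** W) *v trajectory B A W X x0 k \<omega> + A *v X k \<omega>"
  by (simp add: matrix_vector_mult_diff_rdistrib matrix_vector_mult_diff_distrib
      matrix_vector_mul_assoc)

text \<open>Variation of constants: the state is the transient \<open>H\<^sup>k x\<^sub>0\<close> plus the past inputs, weighted by
  powers of \<open>H\<close> according to their age.\<close>

lemma trajectory_closed_form:
  "trajectory B A W X x0 k \<omega>
    = ((*v) (B - A ** W) ^^ k) x0 + (\<Sum>j<k. ((*v) (B - A ** W) ^^ j) (A *v X (k - 1 - j) \<omega>))"
proof (induction k)
  case 0
  show ?case by simp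
next
  case (Suc k)
  let ?H = "(*v) (B - A ** W)"
  have "trajectory B A W X x0 (Suc k) \<omega> = ?H (trajectory B A W X x0 k \<omega>) + A *v X k \<omega>"
    by (rule trajectory_Suc)
  also have "?H (trajectory B A W X x0 k \<omega>)
      = (?H ^^ Suc k) x0 + (\<Sum>j<k. (?H ^^ Suc j) (A *v X (k - 1 - j) \<omega>))"
    unfolding Suc by (simp add: matrix_vector_right_distrib linear_sum[OF matrix_vector_mul_linear])
  also have "\<dots> + A *v X k \<omega>
      = (?H ^^ Suc k) x0 + (\<Sum>j<Suc k. (?H ^^ j) (A *v X (Suc k - 1 - j) \<omega>))"
    by (simp add: sum.lessThan_Suc_shift del: sum.lessThan_Suc)
  finally show ?case .
qed

text \<open>The start enters only through a deterministic summand. This makes the expectations for two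
  starts comparable, and it makes the limits independent of the start when \<open>H\<^sup>k\<close> tends to 0.\<close>

lemma trajectory_superposition:
  "trajectory B A W X x0 k \<omega> = ((*v) (B - A ** W) ^^ k) x0 + trajectory B A W X 0 k \<omega>"
  unfolding trajectory_closed_form[of B A W X x0] trajectory_closed_form[of B A W X 0]
  by (simp add: linear_0[OF linear_matrix_funpow])

lemma convergent_vec_nth: "convergent u \<Longrightarrow> convergent (\<lambda>k. u k $ i)"
  unfolding convergent_def by (auto intro: tendsto_vec_nth)

lemma integral_vec_nth:
  fixes f :: "'w \<Rightarrow> ('a::euclidean_space)^'m"
  shows "integrable M f \<Longrightarrow> (\<integral>\<omega>. f \<omega> $ i \<partial>M) = (\<integral>\<omega>. f \<omega> \<partial>M) $ i"
  by (rule integral_bounded_linear[OF bounded_linear_vec_nth])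

locale driven_system = finite_markov_chain S p \<pi>0 M X
  for S :: "(real^'n) set" and p \<pi>0 and M :: "'w measure" and X +
  fixes B A W :: "real^'n^'n"
begin

abbreviation H :: "real^'n^'n" where "H \<equiv> B - A ** W"

abbreviation x :: "real^'n \<Rightarrow> nat \<Rightarrow> 'w \<Rightarrow> real^'n" where "x \<equiv> trajectory B A W X"

text \<open>At each time the state takes finitely many values, which makes every function of it integrable.\<close>

lemma simple_x: "simple_function M (x x0 k)"
proof (induction k)
  case 0
  show ?case by simp
next
  case (Suc k)
  have "simple_function M (\<lambda>\<omega>. H *v x x0 k \<omega> + A *v X k \<omega>)"
    by (rule simple_function_compose2[OF Suc simple_state])
  then show ?case by (simp only: trajectory_Suc[abs_def])
qed

lemma expectation_superposition:
  "(\<integral>\<omega>. x x0 k \<omega> \<partial>M) = ((*v) H ^^ k) x0 + (\<integral>\<omega>. x 0 k \<omega> \<partial>M)"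
proof -
  have "(\<integral>\<omega>. x x0 k \<omega> \<partial>M) = (\<integral>\<omega>. ((*v) H ^^ k) x0 + x 0 k \<omega> \<partial>M)"
    by (simp only: trajectory_superposition[of B A W X x0])
  also have "\<dots> = ((*v) H ^^ k) x0 + (\<integral>\<omega>. x 0 k \<omega> \<partial>M)"
    by (subst Bochner_Integration.integral_add)
      (simp_all add: integrable_simple_function simple_x prob_space)
  finally show ?thesis .
qed

text \<open>The expectations for the starts \<open>v\<close> and 0 differ by exactly \<open>H\<^sup>k v\<close>, and stability gives both the
  same limit.\<close>

lemma mean_square_stable_imp_schur_stable:
  assumes "mean_square_stable M x"
  shows "schur_stable H"
proof (rule schur_stable_if_orbits_vanish)
  fix v
  obtain \<mu> where \<mu>: "\<And>x0. (\<lambda>k. norm ((\<integral>\<omega>. x x0 k \<omega> \<partial>M) - \<mu>)) \<longlonglongrightarrow> 0"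
    using assms unfolding mean_square_stable_def by blast
  have "(\<lambda>k. \<integral>\<omega>. x x0 k \<omega> \<partial>M) \<longlonglongrightarrow> \<mu>" for x0
    using \<mu>[of x0] by (simp add: tendsto_norm_zero_iff LIM_zero_iff)
  from tendsto_diff[OF this[of v] this[of 0]]
  show "(\<lambda>k. ((*v) H ^^ k) v) \<longlonglongrightarrow> 0" by (simp add: expectation_superposition[of v])
qed

end

locale stable_driven_system =
  driven_system S p \<pi>0 M X B A W + ergodic_finite_chain S p \<pi>0 M X \<pi>
  for S :: "(real^'n) set" and p \<pi>0 and M :: "'w measure" and X B A W \<pi> +
  assumes stable: "schur_stable (B - A ** W)"
begin

lemma forcing_bounded: "\<exists>F\<ge>0. \<forall>k. \<forall>\<omega>\<in>space M. norm (A *v X k \<omega>) \<le> F"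
proof (intro exI[of _ "\<Sum>s\<in>S. norm (A *v s)"] conjI allI ballI)
  show "0 \<le> (\<Sum>s\<in>S. norm (A *v s))" by (simp add: sum_nonneg)
  fix k \<omega> assume "\<omega> \<in> space M"
  from state_in[OF this] show "norm (A *v X k \<omega>) \<le> (\<Sum>s\<in>S. norm (A *v s))"
    by (intro member_le_sum[of _ S "\<lambda>s. norm (A *v s)"] finite_states) auto
qed

text \<open>The inputs are bounded and their weights are dominated by a geometric series.\<close>

lemma x_bounded: "\<exists>G. \<forall>k. \<forall>\<omega>\<in>space M. norm (x x0 k \<omega>) \<le> G"
proof -
  obtain F where F: "0 \<le> F" "\<And>k \<omega>. \<omega> \<in> space M \<Longrightarrow> norm (A *v X k \<omega>) \<le> F"
    using forcing_bounded by blast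
  obtain r C where r: "0 < r" "r < 1" and C: "\<forall>k v. norm (((*v) H ^^ k) v) \<le> C * r ^ k * norm v"
    using schur_stable_geometric[OF stable] .
  have "norm (((*v) H ^^ 0) (axis undefined 1)) \<le> C * r ^ 0 * norm (axis undefined (1::real) :: real^'n)"
    using C by blast
  then have C0: "0 \<le> C" by simp
  have "norm (x x0 k \<omega>) \<le> C * norm x0 + C * F * (1 / (1 - r))" if \<omega>: "\<omega> \<in> space M" for k \<omega>
  proof -
    have "norm (((*v) H ^^ k) x0) \<le> C * r ^ k * norm x0" using C by blast
    also have "\<dots> \<le> C * 1 * norm x0"
      by (intro mult_right_mono mult_left_mono power_le_one) (use r C0 in auto)
    finally have 1: "norm (((*v) H ^^ k) x0) \<le> C * norm x0" by simp
    have "norm (\<Sum>j<k. ((*v) H ^^ j) (A *v X (k - 1 - j) \<omega>)) \<le> (\<Sum>j<k. C * r ^ j * F)"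
    proof (rule sum_norm_le)
      fix j
      have "norm (((*v) H ^^ j) (A *v X (k - 1 - j) \<omega>)) \<le> C * r ^ j * norm (A *v X (k - 1 - j) \<omega>)"
        using C by blast
      also have "\<dots> \<le> C * r ^ j * F" by (rule mult_left_mono[OF F(2)[OF \<omega>]]) (use r C0 in auto)
      finally show "norm (((*v) H ^^ j) (A *v X (k - 1 - j) \<omega>)) \<le> C * r ^ j * F" .
    qed
    also have "\<dots> = C * F * (\<Sum>j<k. r ^ j)" by (simp add: sum_distrib_left mult_ac)
    also have "(\<Sum>j<k. r ^ j) \<le> (\<Sum>j. r ^ j)"
      by (rule sum_le_suminf) (use r in \<open>auto intro: summable_geometric\<close>)
    also have "(\<Sum>j. r ^ j) = 1 / (1 - r)" by (rule suminf_geometric) (use r in auto)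
    finally have 2: "norm (\<Sum>j<k. ((*v) H ^^ j) (A *v X (k - 1 - j) \<omega>)) \<le> C * F * (1 / (1 - r))"
      using C0 F by (simp add: mult_left_mono)
    show ?thesis
      unfolding trajectory_closed_form using norm_triangle_le[OF add_mono[OF 1 2]] .
  qed
  then show ?thesis by blast
qed

text \<open>The central tool. Multiplying the closed form by \<open>Y k\<close> and taking expectations gives the transient,
  which vanishes, and a weighted history of the moments of \<open>Y k\<close> with the inputs. The mean is the case
  \<open>Y k = 1\<close>; the second moments use components of an input and of the state itself.\<close>

lemma moment_convergent:
  fixes Y :: "nat \<Rightarrow> 'w \<Rightarrow> real"
  assumes Y: "\<And>k. simple_function M (Y k)"
    and bound: "\<And>k \<omega>. \<omega> \<in> space M \<Longrightarrow> \<bar>Y k \<omega>\<bar> \<le> G"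
    and conv: "\<And>j. convergent (\<lambda>k. \<integral>\<omega>. Y k \<omega> *\<^sub>R (A *v X (k - 1 - j) \<omega>) \<partial>M)"
  shows "convergent (\<lambda>k. \<integral>\<omega>. Y k \<omega> *\<^sub>R x x0 k \<omega> \<partial>M)"
proof -
  obtain F where F: "0 \<le> F" "\<And>k \<omega>. \<omega> \<in> space M \<Longrightarrow> norm (A *v X k \<omega>) \<le> F"
    using forcing_bounded by blast
  define b where "b k j = (\<integral>\<omega>. Y k \<omega> *\<^sub>R (A *v X (k - 1 - j) \<omega>) \<partial>M)" for k j
  have G0: "0 \<le> G" using bound not_empty by (metis abs_ge_zero equals0I order_trans)
  have bl: "bounded_linear ((*v) H ^^ j)" for j
    using linear_matrix_funpow linear_conv_bounded_linear by blast
  have intY: "integrable M (Y k)" for k by (rule integrable_simple_function[OF Y])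
  have intf: "integrable M (\<lambda>\<omega>. Y k \<omega> *\<^sub>R (A *v X m \<omega>))" for k m
    by (rule integrable_simple_function, rule simple_function_compose2[OF Y simple_state])
  have b_bound: "norm (b k j) \<le> G * F" for k j
  proof -
    have "norm (b k j) \<le> (\<integral>\<omega>. norm (Y k \<omega> *\<^sub>R (A *v X (k - 1 - j) \<omega>)) \<partial>M)"
      unfolding b_def by (rule integral_norm_bound)
    also have "\<dots> \<le> (\<integral>\<omega>. G * F \<partial>M)"
    proof (rule integral_mono[OF integrable_norm[OF intf]])
      fix \<omega> assume "\<omega> \<in> space M"
      from mult_mono[OF bound[OF this] F(2)[OF this] G0] show "norm (Y k \<omega> *\<^sub>R (A *v X (k - 1 - j) \<omega>)) \<le> G * F"
        by simp
    qed simp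
    finally show ?thesis by (simp add: prob_space)
  qed
  have "\<forall>j. \<exists>L. (\<lambda>k. b k j) \<longlonglongrightarrow> L"
    using conv unfolding b_def convergent_def by blast
  from choice[OF this] obtain \<beta> where \<beta>: "\<And>j. (\<lambda>k. b k j) \<longlonglongrightarrow> \<beta> j" by blast
  have "convergent (\<lambda>k. \<Sum>j<k. ((*v) H ^^ j) (b k j))"
    by (rule convergent_weighted_history[OF stable b_bound \<beta>])
  moreover have "(\<lambda>k. (\<integral>\<omega>. Y k \<omega> \<partial>M) *\<^sub>R ((*v) H ^^ k) x0) \<longlonglongrightarrow> 0"
  proof (rule Lim_null_comparison)
    have "\<bar>\<integral>\<omega>. Y k \<omega> \<partial>M\<bar> \<le> G" for k
    proof -
      have "\<bar>\<integral>\<omega>. Y k \<omega> \<partial>M\<bar> \<le> (\<integral>\<omega>. \<bar>Y k \<omega>\<bar> \<partial>M)" by (rule integral_abs_bound)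
      also have "\<dots> \<le> (\<integral>\<omega>. G \<partial>M)" 
        by (rule integral_mono[OF integrable_abs[OF intY]]) (simp_all add: bound)
      finally show ?thesis by (simp add: prob_space)
    qed
    then show "\<forall>\<^sub>F k in sequentially. norm ((\<integral>\<omega>. Y k \<omega> \<partial>M) *\<^sub>R ((*v) H ^^ k) x0)
        \<le> G * norm (((*v) H ^^ k) x0)"
      by (simp add: mult_right_mono)
    show "(\<lambda>k. G * norm (((*v) H ^^ k) x0)) \<longlonglongrightarrow> 0"
      by (rule tendsto_mult_right_zero, rule tendsto_norm_zero, rule schur_stable_orbit_tendsto[OF stable])
  qed
  moreover have "(\<integral>\<omega>. Y k \<omega> *\<^sub>R x x0 k \<omega> \<partial>M)
      = (\<integral>\<omega>. Y k \<omega> \<partial>M) *\<^sub>R ((*v) H ^^ k) x0 + (\<Sum>j<k. ((*v) H ^^ j) (b k j))" for k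
  proof -
    have int_step: "integrable M (\<lambda>\<omega>. ((*v) H ^^ j) (Y k \<omega> *\<^sub>R (A *v X m \<omega>)))" for j m
      by (rule integrable_bounded_linear[OF bl intf])
    have "(\<integral>\<omega>. Y k \<omega> *\<^sub>R x x0 k \<omega> \<partial>M)
        = (\<integral>\<omega>. Y k \<omega> *\<^sub>R ((*v) H ^^ k) x0
            + (\<Sum>j<k. ((*v) H ^^ j) (Y k \<omega> *\<^sub>R (A *v X (k - 1 - j) \<omega>))) \<partial>M)"
      unfolding trajectory_closed_form
      by (simp add: scaleR_add_right scaleR_sum_right linear_scale[OF linear_matrix_funpow])
    also have "\<dots> = (\<integral>\<omega>. Y k \<omega> \<partial>M) *\<^sub>R ((*v) H ^^ k) x0
            + (\<Sum>j<k. \<integral>\<omega>. ((*v) H ^^ j) (Y k \<omega> *\<^sub>R (A *v X (k - 1 - j) \<omega>)) \<partial>M)"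
      using intY int_step
      by (simp add: Bochner_Integration.integral_add Bochner_Integration.integral_sum)
    also have "(\<Sum>j<k. \<integral>\<omega>. ((*v) H ^^ j) (Y k \<omega> *\<^sub>R (A *v X (k - 1 - j) \<omega>)) \<partial>M)
        = (\<Sum>j<k. ((*v) H ^^ j) (b k j))"
      unfolding b_def by (intro sum.cong refl integral_bounded_linear[OF bl intf])
    finally show ?thesis .
  qed
  ultimately show ?thesis
    using convergent_add[OF convergentI] by simp
qed

text \<open>Once the mean is known to converge, its limit is found by letting \<open>k\<close> tend to infinity in the
  recursion: \<open>\<mu> = H \<mu> + f\<close>, where \<open>f\<close> is the stationary mean of the input.\<close>

lemma mean_tendsto:
  "(\<lambda>k. \<integral>\<omega>. x x0 k \<omega> \<partial>M) \<longlonglongrightarrow> matrix_inv (mat 1 - H) *v (\<Sum>s\<in>S. \<pi> s *\<^sub>R (A *v s))"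
proof -
  let ?f = "\<Sum>s\<in>S. \<pi> s *\<^sub>R (A *v s)"
  have "convergent (\<lambda>k. \<integral>\<omega>. 1 *\<^sub>R x x0 k \<omega> \<partial>M)"
  proof (rule moment_convergent[where G = 1])
    show "convergent (\<lambda>k. \<integral>\<omega>. 1 *\<^sub>R (A *v X (k - 1 - j) \<omega>) \<partial>M)" for j
      using correlation_convergent[of "\<lambda>s t. A *v s" j j] by simp
  qed auto
  then obtain \<mu> where \<mu>: "(\<lambda>k. \<integral>\<omega>. x x0 k \<omega> \<partial>M) \<longlonglongrightarrow> \<mu>" by (auto simp: convergent_def)
  have "(\<integral>\<omega>. x x0 (Suc k) \<omega> \<partial>M) = H *v (\<integral>\<omega>. x x0 k \<omega> \<partial>M) + (\<integral>\<omega>. A *v X k \<omega> \<partial>M)" for k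
  proof -
    have intx: "integrable M (x x0 k)" by (rule integrable_simple_function[OF simple_x])
    have intf: "integrable M (\<lambda>\<omega>. A *v X k \<omega>)"
      by (rule integrable_simple_function, rule simple_function_compose1[OF simple_state])
    have bl: "bounded_linear ((*v) H)" by (rule matrix_vector_mul_bounded_linear)
    have "(\<integral>\<omega>. x x0 (Suc k) \<omega> \<partial>M) = (\<integral>\<omega>. H *v x x0 k \<omega> \<partial>M) + (\<integral>\<omega>. A *v X k \<omega> \<partial>M)"
      unfolding trajectory_Suc
      by (rule Bochner_Integration.integral_add[OF integrable_bounded_linear[OF bl intx] intf])
    also have "(\<integral>\<omega>. H *v x x0 k \<omega> \<partial>M) = H *v (\<integral>\<omega>. x x0 k \<omega> \<partial>M)"
      by (rule integral_bounded_linear[OF bl intx])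
    finally show ?thesis .
  qed
  moreover have "(\<lambda>k. H *v (\<integral>\<omega>. x x0 k \<omega> \<partial>M) + (\<integral>\<omega>. A *v X k \<omega> \<partial>M)) \<longlonglongrightarrow> H *v \<mu> + ?f"
    by (intro tendsto_add expectation_state_tendsto
        bounded_linear.tendsto[OF matrix_vector_mul_bounded_linear \<mu>])
  ultimately have "(\<lambda>k. \<integral>\<omega>. x x0 (Suc k) \<omega> \<partial>M) \<longlonglongrightarrow> H *v \<mu> + ?f" by (simp only:)
  with LIMSEQ_Suc[OF \<mu>] have "\<mu> = H *v \<mu> + ?f" by (rule LIMSEQ_unique)
  then have eq: "(mat 1 - H) *v \<mu> = ?f"
    unfolding matrix_vector_mult_diff_rdistrib[of "mat 1" H] matrix_vector_mul_lid
    by (metis add_diff_cancel_left')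
  have inv: "matrix_inv (mat 1 - H) ** (mat 1 - H) = mat 1"
    using someI_ex[OF schur_stable_invertible[OF stable, unfolded invertible_def]]
    unfolding matrix_inv_def by blast
  have "\<mu> = matrix_inv (mat 1 - H) *v ?f"
    unfolding eq[symmetric] matrix_vector_mul_assoc inv by simp
  with \<mu> show ?thesis by simp
qed

text \<open>The lemma \<open>moment_convergent\<close> is used twice. With \<open>Y k\<close> a component of an input of age \<open>j\<close>, it reduces the
  state-input moments to correlations of the chain; with \<open>Y k\<close> a component of the state, it reduces
  the second moments to these state-input moments.\<close>

lemma second_moment_convergent: "convergent (\<lambda>k. \<integral>\<omega>. x x0 k \<omega> $ u * x x0 k \<omega> $ v \<partial>M)"
proof -
  obtain F where F: "0 \<le> F" "\<And>k \<omega>. \<omega> \<in> space M \<Longrightarrow> norm (A *v X k \<omega>) \<le> F"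
    using forcing_bounded by blast
  obtain G where G: "\<And>k \<omega>. \<omega> \<in> space M \<Longrightarrow> norm (x x0 k \<omega>) \<le> G"
    using x_bounded by blast
  have int: "integrable M (\<lambda>\<omega>. g (X l \<omega>) (x x0 k \<omega>))" for l k and g :: "_ \<Rightarrow> _ \<Rightarrow> real^'n"
    by (rule integrable_simple_function, rule simple_function_compose2[OF simple_state simple_x])
  have cross: "convergent (\<lambda>k. \<integral>\<omega>. (A *v X (k - 1 - j) \<omega>) $ w *\<^sub>R x x0 k \<omega> \<partial>M)" for j w
  proof (rule moment_convergent)
    show "simple_function M (\<lambda>\<omega>. (A *v X (k - 1 - j) \<omega>) $ w)" for k
      by (rule simple_function_compose1[OF simple_state])
    show "\<bar>(A *v X (k - 1 - j) \<omega>) $ w\<bar> \<le> F" if "\<omega> \<in> space M" for k \<omega>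
      using F(2)[OF that] component_le_norm_cart order_trans by blast
    show "convergent (\<lambda>k. \<integral>\<omega>. (A *v X (k - 1 - j) \<omega>) $ w *\<^sub>R (A *v X (k - 1 - l) \<omega>) \<partial>M)" for l
      by (rule correlation_convergent)
  qed
  have "convergent (\<lambda>k. \<integral>\<omega>. x x0 k \<omega> $ u *\<^sub>R x x0 k \<omega> \<partial>M)"
  proof (rule moment_convergent)
    show "simple_function M (\<lambda>\<omega>. x x0 k \<omega> $ u)" for k
      by (rule simple_function_compose1[OF simple_x])
    show "\<bar>x x0 k \<omega> $ u\<bar> \<le> G" if "\<omega> \<in> space M" for k \<omega>
      using G[OF that] component_le_norm_cart order_trans by blast
    show "convergent (\<lambda>k. \<integral>\<omega>. x x0 k \<omega> $ u *\<^sub>R (A *v X (k - 1 - j) \<omega>) \<partial>M)" for j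
    proof (rule convergent_vec)
      fix w
      \<comment> \<open>The matrix of state-input moments, read by rows instead of columns.\<close>
      have "(\<integral>\<omega>. x x0 k \<omega> $ u *\<^sub>R (A *v X (k - 1 - j) \<omega>) \<partial>M) $ w
          = (\<integral>\<omega>. (A *v X (k - 1 - j) \<omega>) $ w *\<^sub>R x x0 k \<omega> \<partial>M) $ u" for k
        unfolding integral_vec_nth[symmetric, OF int[of "\<lambda>s y. y $ u *\<^sub>R (A *v s)"]]
          integral_vec_nth[symmetric, OF int[of "\<lambda>s y. (A *v s) $ w *\<^sub>R y"]]
        by (simp add: mult.commute)
      then show "convergent (\<lambda>k. (\<integral>\<omega>. x x0 k \<omega> $ u *\<^sub>R (A *v X (k - 1 - j) \<omega>) \<partial>M) $ w)"
        using convergent_vec_nth[OF cross] by simp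
    qed
  qed
  from convergent_vec_nth[OF this, of v]
  show ?thesis
    unfolding integral_vec_nth[symmetric, OF int[of "\<lambda>s y. y $ u *\<^sub>R y"]] by simp
qed

text \<open>With \<open>d = H\<^sup>k x\<^sub>0\<close> the difference of the two trajectories \<open>x\<close> and \<open>y\<close>, the identity
  \<open>x\<^sub>u x\<^sub>v - y\<^sub>u y\<^sub>v = d\<^sub>u x\<^sub>v + d\<^sub>v y\<^sub>u\<close> leaves only convergent means multiplied by null sequences.\<close>

lemma second_moment_forgets_start:
  "(\<lambda>k. (\<integral>\<omega>. x x0 k \<omega> $ u * x x0 k \<omega> $ v \<partial>M) - (\<integral>\<omega>. x 0 k \<omega> $ u * x 0 k \<omega> $ v \<partial>M)) \<longlonglongrightarrow> 0"
proof -
  define d where "d k = ((*v) H ^^ k) x0" for k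
  let ?m = "\<lambda>x0 k. \<integral>\<omega>. x x0 k \<omega> \<partial>M"
  have int: "integrable M (\<lambda>\<omega>. g (x x0 k \<omega>))" for x0 k and g :: "_ \<Rightarrow> real"
    by (rule integrable_simple_function, rule simple_function_compose1[OF simple_x])
  have nth: "(\<integral>\<omega>. x y k \<omega> $ i \<partial>M) = ?m y k $ i" for y k i
    by (rule integral_vec_nth[OF integrable_simple_function[OF simple_x]])
  have eq: "(\<integral>\<omega>. x x0 k \<omega> $ u * x x0 k \<omega> $ v \<partial>M) - (\<integral>\<omega>. x 0 k \<omega> $ u * x 0 k \<omega> $ v \<partial>M)
      = d k $ u * ?m x0 k $ v + d k $ v * ?m 0 k $ u" for k
  proof -
    have d: "x x0 k \<omega> = d k + x 0 k \<omega>" for \<omega>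
      unfolding d_def by (rule trajectory_superposition)
    have "(\<integral>\<omega>. x x0 k \<omega> $ u * x x0 k \<omega> $ v \<partial>M) - (\<integral>\<omega>. x 0 k \<omega> $ u * x 0 k \<omega> $ v \<partial>M)
        = (\<integral>\<omega>. x x0 k \<omega> $ u * x x0 k \<omega> $ v - x 0 k \<omega> $ u * x 0 k \<omega> $ v \<partial>M)"
      by (rule Bochner_Integration.integral_diff[symmetric]; rule int)
    also have "\<dots> = (\<integral>\<omega>. d k $ u * x x0 k \<omega> $ v + d k $ v * x 0 k \<omega> $ u \<partial>M)"
      by (simp add: d algebra_simps)
    also have "\<dots> = (\<integral>\<omega>. d k $ u * x x0 k \<omega> $ v \<partial>M) + (\<integral>\<omega>. d k $ v * x 0 k \<omega> $ u \<partial>M)"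
      by (rule Bochner_Integration.integral_add; rule int)
    finally show ?thesis by (simp add: nth)
  qed
  have "d \<longlonglongrightarrow> 0" unfolding d_def by (rule schur_stable_orbit_tendsto[OF stable])
  then have "(\<lambda>k. d k $ i) \<longlonglongrightarrow> 0" for i using tendsto_vec_nth[of d 0] by simp
  then have "(\<lambda>k. d k $ u * ?m x0 k $ v + d k $ v * ?m 0 k $ u)
      \<longlonglongrightarrow> 0 * (matrix_inv (mat 1 - H) *v (\<Sum>s\<in>S. \<pi> s *\<^sub>R (A *v s))) $ v
        + 0 * (matrix_inv (mat 1 - H) *v (\<Sum>s\<in>S. \<pi> s *\<^sub>R (A *v s))) $ u"
    by (intro tendsto_intros mean_tendsto)
  then show ?thesis by (simp add: eq)
qed

lemma mean_square_stable: "mean_square_stable M x"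
proof -
  define Q where "Q = (\<chi> u v. lim (\<lambda>k. \<integral>\<omega>. x 0 k \<omega> $ u * x 0 k \<omega> $ v \<partial>M))"
  have q: "(\<lambda>k. \<integral>\<omega>. x 0 k \<omega> $ u * x 0 k \<omega> $ v \<partial>M) \<longlonglongrightarrow> Q $ u $ v" for u v
    using second_moment_convergent[of 0 u v] by (simp add: Q_def convergent_LIMSEQ_iff)
  have int: "integrable M (\<lambda>\<omega>. outer_square (x x0 k \<omega>))" for x0 k
    by (rule integrable_simple_function, rule simple_function_compose1[OF simple_x])
  have int_row: "integrable M (\<lambda>\<omega>. outer_square (x x0 k \<omega>) $ u)" for x0 k u
    by (rule integrable_simple_function, rule simple_function_compose1[OF simple_x])
  have "(\<lambda>k. \<integral>\<omega>. outer_square (x x0 k \<omega>) \<partial>M) \<longlonglongrightarrow> Q" for x0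
  proof (intro vec_tendstoI)
    fix u v
    have "(\<integral>\<omega>. outer_square (x x0 k \<omega>) \<partial>M) $ u $ v = (\<integral>\<omega>. x x0 k \<omega> $ u * x x0 k \<omega> $ v \<partial>M)" for k
      unfolding integral_vec_nth[symmetric, OF int] integral_vec_nth[symmetric, OF int_row]
      by (simp add: outer_square_def)
    moreover have "(\<lambda>k. \<integral>\<omega>. x x0 k \<omega> $ u * x x0 k \<omega> $ v \<partial>M) \<longlonglongrightarrow> Q $ u $ v"
      using tendsto_add[OF second_moment_forgets_start[of x0 u v] q[of u v]] by simp
    ultimately show "(\<lambda>k. (\<integral>\<omega>. outer_square (x x0 k \<omega>) \<partial>M) $ u $ v) \<longlonglongrightarrow> Q $ u $ v"
      by (simp only:)
  qed
  then show ?thesis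
    unfolding mean_square_stable_def tendsto_norm_zero_iff LIM_zero_iff
    using mean_tendsto by blast
qed

end

section \<open>Binary states and the stability criterion\<close>

lemma finite_binary_states: "finite (binary_states :: (real^'n) set)"
proof (rule inj_on_finite[of "\<lambda>s. {i. s $ i = 1}"])
  show "inj_on (\<lambda>s :: real^'n. {i. s $ i = 1}) binary_states"
    
  proof (rule inj_onI)
    fix s t :: "real^'n"
    assume st: "s \<in> binary_states" "t \<in> binary_states" and eq: "{i. s $ i = 1} = {i. t $ i = 1}"
    have "s $ i = t $ i" for i
    proof -
      have "s $ i = 1 \<longleftrightarrow> t $ i = 1" using eq by blast
      moreover have "s $ i = 0 \<or> s $ i = 1" "t $ i = 0 \<or> t $ i = 1"
        using st by (auto simp: binary_states_def)
      ultimately show ?thesis by auto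
    qed
    then show "s = t" by (simp add: vec_eq_iff)
  qed
qed auto

lemma zero_binary_state: "0 \<in> binary_states"
  by (simp add: binary_states_def)

lemma diag_matrix_mult_commute: "diag_matrix a *v s = diag_matrix s *v a"
  by (simp add: diag_matrix_def matrix_vector_mult_def vec_eq_iff if_distrib[of "\<lambda>y. y * _"]
      cong: if_cong)

text \<open>What remains is to feed the chain on the binary states into the two general implications. The
  stated form of the limit uses that \<open>diag(a) i = diag(i) a\<close>.\<close>

theorem theorem6:
  fixes B W A :: "real^'n^'n" and a :: "real^'n"
    and p :: "real^'n \<Rightarrow> real^'n \<Rightarrow> real" and \<pi>0 :: "real^'n \<Rightarrow> real"
    and M :: "'w measure" and X :: "nat \<Rightarrow> 'w \<Rightarrow> real^'n"
  assumes "row_stochastic B" and "row_stochastic W"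
    and "A = diag_matrix a" and "0 \<le> A" and "A \<le> mat 1"
    and "markov_chain_on binary_states p \<pi>0 M X"
    and "irreducible_on binary_states p" and "aperiodic_on binary_states p"
  shows "(mean_square_stable M (trajectory B A W X) \<longleftrightarrow> schur_stable (B - A ** W)) \<and>
    (\<exists>\<pi>. invariant_distribution_on binary_states p \<pi> \<and>
       (\<forall>\<pi>'. invariant_distribution_on binary_states p \<pi>' \<longrightarrow> (\<forall>i\<in>binary_states. \<pi>' i = \<pi> i)) \<and>
       (schur_stable (B - A ** W) \<longrightarrow>
          invertible (mat 1 - B + A ** W) \<and>
          (\<forall>x0. (\<lambda>k. \<integral>\<omega>. trajectory B A W X x0 k \<omega> \<partial>M) \<longlonglongrightarrow>
             matrix_inv (mat 1 - B + A ** W) *v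
               (\<Sum>i\<in>binary_states. \<pi> i *\<^sub>R (diag_matrix i *v a)))))"
proof -
  interpret driven_system binary_states p \<pi>0 M X B A W
    by unfold_locales (use finite_binary_states assms(6) in auto)
  have st: "stochastic_on binary_states p" using assms(6) by (simp only: markov_chain_on_def)
  obtain \<pi> where inv: "invariant_distribution_on binary_states p \<pi>"
    and uniq: "\<forall>\<pi>'. invariant_distribution_on binary_states p \<pi>' \<longrightarrow> (\<forall>i\<in>binary_states. \<pi>' i = \<pi> i)"
    and lim: "\<forall>i\<in>binary_states. \<forall>j\<in>binary_states. (\<lambda>k. power_on binary_states p k i j) \<longlonglongrightarrow> \<pi> j"
  proof (rule finite_chain_converges[OF finite_binary_states _ st assms(7,8)])
    show "binary_states \<noteq> ({} :: (real^'n) set)" using zero_binary_state by blast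
  qed
  have sys: "stable_driven_system binary_states p \<pi>0 M X B A W \<pi>" if "schur_stable (B - A ** W)"
    by unfold_locales (use lim that in auto)
  have inverse: "mat 1 - B + A ** W = mat 1 - (B - A ** W)" by simp
  have limit: "(\<Sum>i\<in>binary_states. \<pi> i *\<^sub>R (diag_matrix i *v a)) = (\<Sum>i\<in>binary_states. \<pi> i *\<^sub>R (A *v i))"
    unfolding assms(3) by (simp only: diag_matrix_mult_commute[of a])
  show ?thesis
  proof (intro conjI exI[of _ \<pi>] allI impI ballI iffI)
    show "schur_stable (B - A ** W)" if "mean_square_stable M (trajectory B A W X)"
      using that by (rule mean_square_stable_imp_schur_stable)
    show "mean_square_stable M (trajectory B A W X)" if "schur_stable (B - A ** W)"
      using sys[OF that] by (rule stable_driven_system.mean_square_stable)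
    show "(\<lambda>k. \<integral>\<omega>. trajectory B A W X x0 k \<omega> \<partial>M) \<longlonglongrightarrow>
        matrix_inv (mat 1 - B + A ** W) *v (\<Sum>i\<in>binary_states. \<pi> i *\<^sub>R (diag_matrix i *v a))"
      if "schur_stable (B - A ** W)" for x0
      unfolding inverse limit using sys[OF that] by (rule stable_driven_system.mean_tendsto)
    show "invertible (mat 1 - B + A ** W)" if "schur_stable (B - A ** W)"
      unfolding inverse using that by (rule schur_stable_invertible)
  qed (use inv uniq in auto)
qed

end
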